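(* Let $A,B\in\mathcal B^{+*}(H)$ and $v\in[0,1]$. Then $$A\sharp_v B\leq\Big(A\sharp_{\frac{v}{2}}B\Big)\nabla_v\Big(A\sharp_{\frac{1+v}{2}}B\Big)\leq L_v(A,B)\leq(A\sharp_v B)\nabla(A\nabla_v B)\leq A\nabla_v B$$ and $$A\sharp_v B\leq\big(A\nabla_v B\big)\sharp\big(A\sharp_v B\big)\leq I_v(A,B)\leq\big(A\nabla_{\frac{v}{2}}B\big)\sharp_v\big(A\nabla_{\frac{1+v}{2}}B\big)\leq A\nabla_v B.$$
   Context: $H$ is a complex Hilbert space, $\mathcal B(H)$ the $C^*$-algebra of bounded linear operators on $H$, and $\mathcal B^{+*}(H)$ the open cone of all (self-adjoint) positive invertible operators in $\mathcal B(H)$. For self-adjoint $A,B\in\mathcal B(H)$, $A\le B$ means that $B-A$ is positive semi-definite. For $A,B\in\mathcal B^{+*}(H)$ and $v\in[0,1]$: $$A\nabla_v B=(1-v)A+vB,\qquad A\sharp_v B=A^{1/2}\big(A^{-1/2}BA^{-1/2}\big)^vA^{1/2},$$ and for $v=1/2$ one writes $A\nabla B$ and $A\sharp B$. Scalar weighted logarithmic and identric means: for $a\neq b$ in $(0,\infty)$ and $v\in(0,1)$, with $a\nabla_v b=(1-v)a+vb$, $$L_v(a,b)=\frac{1}{\log a-\log b}\left(\frac{1-v}{v}\big(a-a^{1-v}b^v\big)+\frac{v}{1-v}\big(a^{1-v}b^v-b\big)\right),$$ $$I_v(a,b)=\frac1e\,\big(a\nabla_v b\big)^{\frac{(1-2v)(a\nabla_v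 b)}{v(1-v)(b-a)}}\left(\frac{b^{\frac{vb}{1-v}}}{a^{\frac{(1-v)a}{v}}}\right)^{\frac1{b-a}},$$ with the limit values $L_0(a,b)=I_0(a,b)=a$, $L_1(a,b)=I_1(a,b)=b$, and $L_v(a,a)=I_v(a,a)=a$. The weighted logarithmic and identric means of operators $A,B\in\mathcal B^{+*}(H)$ are defined by continuous functional calculus: $$L_v(A,B)=A^{1/2}F_{L_v}\big(A^{-1/2}BA^{-1/2}\big)A^{1/2},\quad F_{L_v}(x)=L_v(1,x),$$ $$I_v(A,B)=A^{1/2}F_{I_v}\big(A^{-1/2}BA^{-1/2}\big)A^{1/2},\quad F_{I_v}(x)=I_v(1,x),$$ for $x>0$. *)

theory Defs
  imports "HOL-Analysis.Analysis" "HOL-Computational_Algebra.Polynomial"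
begin

section \<open>Complex Hilbert spaces\<close>

text \<open>
  A complex Hilbert space is presented on top of its underlying real Hilbert space, whose inner
  product is the real part of the complex one; the norm is then
  \<open>norm x = sqrt (Re (cinner x x))\<close>, and bounded real-linear operators are the library
  type \<open>'a \<Rightarrow>\<^sub>L 'a\<close>.  The complex inner product is linear in its first argument.
\<close>

class complex_hilbert_space = real_inner + complete_space +
  fixes scaleC :: "complex \<Rightarrow> 'a \<Rightarrow> 'a" (infixr \<open>*\<^sub>C\<close> 75)
    and cinner :: "'a \<Rightarrow> 'a \<Rightarrow> complex"
  assumes scaleC_add_right: "c *\<^sub>C (x + y) = c *\<^sub>C x + c *\<^sub>C y"
    and scaleC_add_left: "(c + d) *\<^sub>C x = c *\<^sub>C x + d *\<^sub>C x"
    and scaleC_scaleC: "c *\<^sub>C d *\<^sub>C x = (c * d) *\<^sub>C x"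
    and scaleR_conv_scaleC: "scaleR r x = complex_of_real r *\<^sub>C x"
    and cinner_commute: "cinner x y = cnj (cinner y x)"
    and cinner_add_left: "cinner (x + y) z = cinner x z + cinner y z"
    and cinner_scaleC_left: "cinner (c *\<^sub>C x) y = c * cinner x y"
    and inner_conv_cinner: "inner x y = Re (cinner x y)"

instantiation complex :: complex_hilbert_space
begin

definition scaleC_complex :: "complex \<Rightarrow> complex \<Rightarrow> complex"
  where "scaleC_complex c x = c * x"

definition cinner_complex :: "complex \<Rightarrow> complex \<Rightarrow> complex"
  where "cinner_complex x y = x * cnj y"

instance
  by standard
    (simp_all add: scaleC_complex_def cinner_complex_def scaleR_conv_of_real inner_complex_def
      algebra_simps)

end

lemma norm_conv_cinner: "norm x = sqrt (Re (cinner x x))"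
  for x :: "'a::complex_hilbert_space"
  by (simp add: norm_eq_sqrt_inner inner_conv_cinner)

lemma cinner_self_real: "cinner x x = complex_of_real ((norm x)\<^sup>2)"
  for x :: "'a::complex_hilbert_space"
proof -
  have "Im (cinner x x) = 0"
    using cinner_commute[of x x] by (metis cnj.simps(2) eq_neg_iff_add_eq_0 mult_2 mult_eq_0_iff
        zero_neq_numeral)
  then show ?thesis
    by (simp add: complex_eq_iff power2_norm_eq_inner inner_conv_cinner)
qed

lemma norm_scaleC: "norm (c *\<^sub>C x) = cmod c * norm x"
  for x :: "'a::complex_hilbert_space"
proof -
  have "cinner (c *\<^sub>C x) (c *\<^sub>C x) = (c * cnj c) * cinner x x"
    by (metis cinner_commute cinner_scaleC_left complex_cnj_mult mult.assoc)
  also have "\<dots> = complex_of_real ((cmod c * norm x)\<^sup>2)"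
    by (simp add: cinner_self_real complex_norm_square power_mult_distrib del: of_real_power)
  finally have "(norm (c *\<^sub>C x))\<^sup>2 = (cmod c * norm x)\<^sup>2"
    by (metis cinner_self_real of_real_eq_iff)
  then show ?thesis
    by simp
qed

lemma bounded_linear_scaleC: "bounded_linear (\<lambda>x::'a::complex_hilbert_space. c *\<^sub>C x)"
proof (rule bounded_linear_intro[where K = "cmod c"])
  show "c *\<^sub>C (r *\<^sub>R x) = r *\<^sub>R (c *\<^sub>C x)" for r and x :: 'a
    by (simp add: scaleR_conv_scaleC scaleC_scaleC mult.commute)
qed (simp_all add: scaleC_add_right norm_scaleC mult.commute)


section \<open>Bounded operators\<close>

definition bounded_operators :: "('a::complex_hilbert_space \<Rightarrow>\<^sub>L 'a) set"
  where "bounded_operators = {T. \<forall>c x. blinfun_apply T (c *\<^sub>C x) = c *\<^sub>C blinfun_apply T x}"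

lift_definition scalar_op :: "complex \<Rightarrow> 'a::complex_hilbert_space \<Rightarrow>\<^sub>L 'a"
  is "\<lambda>c x. c *\<^sub>C x"
  by (rule bounded_linear_scaleC)

definition selfadjoint_op :: "('a::complex_hilbert_space \<Rightarrow>\<^sub>L 'a) \<Rightarrow> bool"
  where "selfadjoint_op T \<longleftrightarrow> T \<in> bounded_operators \<and>
    (\<forall>x y. cinner (blinfun_apply T x) y = cinner x (blinfun_apply T y))"

definition positive_op :: "('a::complex_hilbert_space \<Rightarrow>\<^sub>L 'a) \<Rightarrow> bool"
  where "positive_op T \<longleftrightarrow> selfadjoint_op T \<and> (\<forall>x. 0 \<le> Re (cinner (blinfun_apply T x) x))"

definition invertible_op :: "('a::complex_hilbert_space \<Rightarrow>\<^sub>L 'a) \<Rightarrow> bool"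
  where "invertible_op T \<longleftrightarrow>
    (\<exists>S \<in> bounded_operators. S o\<^sub>L T = id_blinfun \<and> T o\<^sub>L S = id_blinfun)"

definition positive_invertible_ops :: "('a::complex_hilbert_space \<Rightarrow>\<^sub>L 'a) set"
  where "positive_invertible_ops = {T. positive_op T \<and> invertible_op T}"

definition op_le :: "('a::complex_hilbert_space \<Rightarrow>\<^sub>L 'a) \<Rightarrow> ('a \<Rightarrow>\<^sub>L 'a) \<Rightarrow> bool"
    (infix \<open>\<preceq>\<close> 50)
  where "A \<preceq> B \<longleftrightarrow> positive_op (B - A)"


section \<open>Continuous functional calculus\<close>

definition op_spectrum :: "('a::complex_hilbert_space \<Rightarrow>\<^sub>L 'a) \<Rightarrow> complex set"
  where "op_spectrum T = {z. \<not> invertible_op (T - scalar_op z)}"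

definition op_power :: "('a::complex_hilbert_space \<Rightarrow>\<^sub>L 'a) \<Rightarrow> nat \<Rightarrow> ('a \<Rightarrow>\<^sub>L 'a)"
  where "op_power T n = ((\<lambda>S. T o\<^sub>L S) ^^ n) id_blinfun"

definition poly_op :: "real poly \<Rightarrow> ('a::complex_hilbert_space \<Rightarrow>\<^sub>L 'a) \<Rightarrow> ('a \<Rightarrow>\<^sub>L 'a)"
  where "poly_op p T = (\<Sum>i\<le>degree p. coeff p i *\<^sub>R op_power T i)"

text \<open>
  For self-adjoint \<open>T\<close> (whose spectrum is real) and real \<open>f\<close> continuous on the spectrum,
  \<open>cfc f T\<close> is the operator-norm limit of \<open>p\<^sub>n(T)\<close>, for polynomials \<open>p\<^sub>n\<close> converging to \<open>f\<close>
  uniformly on the spectrum; the limit does not depend on the choice of the polynomials.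
  For other arguments the value is not meaningful.
\<close>

definition cfc :: "(real \<Rightarrow> real) \<Rightarrow> ('a::complex_hilbert_space \<Rightarrow>\<^sub>L 'a) \<Rightarrow> ('a \<Rightarrow>\<^sub>L 'a)"
  where "cfc f T = (THE S. \<exists>p :: nat \<Rightarrow> real poly.
    uniform_limit {x. complex_of_real x \<in> op_spectrum T} (\<lambda>n. poly (p n)) f sequentially \<and>
    (\<lambda>n. poly_op (p n) T) \<longlonglongrightarrow> S)"

definition op_powr :: "('a::complex_hilbert_space \<Rightarrow>\<^sub>L 'a) \<Rightarrow> real \<Rightarrow> ('a \<Rightarrow>\<^sub>L 'a)"
  where "op_powr A r = cfc (\<lambda>x. x powr r) A"


section \<open>Weighted means\<close>

definition log_mean :: "real \<Rightarrow> real \<Rightarrow> real \<Rightarrow> real"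
  where "log_mean v a b =
    (if a = b \<or> v = 0 then a else if v = 1 then b else
      1 / (ln a - ln b) *
        ((1 - v) / v * (a - a powr (1 - v) * b powr v) +
         v / (1 - v) * (a powr (1 - v) * b powr v - b)))"

definition identric_mean :: "real \<Rightarrow> real \<Rightarrow> real \<Rightarrow> real"
  where "identric_mean v a b =
    (if a = b \<or> v = 0 then a else if v = 1 then b else
      let m = (1 - v) * a + v * b in
      1 / exp 1 * m powr ((1 - 2 * v) * m / (v * (1 - v) * (b - a))) *
        (b powr (v * b / (1 - v)) / a powr ((1 - v) * a / v)) powr (1 / (b - a)))"

definition op_mean ::
    "(real \<Rightarrow> real) \<Rightarrow> ('a::complex_hilbert_space \<Rightarrow>\<^sub>L 'a) \<Rightarrow> ('a \<Rightarrow>\<^sub>L 'a) \<Rightarrow> ('a \<Rightarrow>\<^sub>L 'a)"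
  where "op_mean f A B =
    op_powr A (1/2) o\<^sub>L cfc f (op_powr A (-1/2) o\<^sub>L B o\<^sub>L op_powr A (-1/2)) o\<^sub>L op_powr A (1/2)"

definition op_arith_mean ::
    "('a::complex_hilbert_space \<Rightarrow>\<^sub>L 'a) \<Rightarrow> real \<Rightarrow> ('a \<Rightarrow>\<^sub>L 'a) \<Rightarrow> ('a \<Rightarrow>\<^sub>L 'a)"
    (\<open>(_ \<nabla>\<^bsub>_\<^esub> _)\<close> [66, 0, 66] 65)
  where "A \<nabla>\<^bsub>v\<^esub> B = (1 - v) *\<^sub>R A + v *\<^sub>R B"

definition op_geom_mean ::
    "('a::complex_hilbert_space \<Rightarrow>\<^sub>L 'a) \<Rightarrow> real \<Rightarrow> ('a \<Rightarrow>\<^sub>L 'a) \<Rightarrow> ('a \<Rightarrow>\<^sub>L 'a)"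
    (\<open>(_ \<sharp>\<^bsub>_\<^esub> _)\<close> [66, 0, 66] 65)
  where "A \<sharp>\<^bsub>v\<^esub> B = op_mean (\<lambda>x. x powr v) A B"

abbreviation op_arith_mean_half (infix \<open>\<nabla>\<close> 65)
  where "A \<nabla> B \<equiv> A \<nabla>\<^bsub>1/2\<^esub> B"

abbreviation op_geom_mean_half (infix \<open>\<sharp>\<close> 65)
  where "A \<sharp> B \<equiv> A \<sharp>\<^bsub>1/2\<^esub> B"

definition op_log_mean ::
    "real \<Rightarrow> ('a::complex_hilbert_space \<Rightarrow>\<^sub>L 'a) \<Rightarrow> ('a \<Rightarrow>\<^sub>L 'a) \<Rightarrow> ('a \<Rightarrow>\<^sub>L 'a)"
  where "op_log_mean v A B = op_mean (\<lambda>x. log_mean v 1 x) A B"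

definition op_identric_mean ::
    "real \<Rightarrow> ('a::complex_hilbert_space \<Rightarrow>\<^sub>L 'a) \<Rightarrow> ('a \<Rightarrow>\<^sub>L 'a) \<Rightarrow> ('a \<Rightarrow>\<^sub>L 'a)"
  where "op_identric_mean v A B = op_mean (\<lambda>x. identric_mean v 1 x) A B"

end

theory Submission
  imports Defs "HOL-Computational_Algebra.Fundamental_Theorem_Algebra"
begin

text \<open>
  Every mean involved has the form \<open>A\<^sup>1\<^sup>/\<^sup>2 f(T) A\<^sup>1\<^sup>/\<^sup>2\<close> with
  \<open>T = A\<^sup>-\<^sup>1\<^sup>/\<^sup>2 B A\<^sup>-\<^sup>1\<^sup>/\<^sup>2\<close>; for the nested geometric means this is the congruence
  invariance of \<open>\<sharp>\<close>.  Monotonicity of the functional calculus therefore reduces both chains to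
  inequalities between the functions \<open>f\<close>.  With \<open>m = 1 - v + v x\<close> and the unweighted
  logarithmic and identric means \<open>L\<close> and \<open>I\<close>, the scalar weighted means split as
  \<open>L\<^sub>v(1, x) = (1 - v) L(1, x\<^sup>v) + v L(x\<^sup>v, x)\<close> and
  \<open>I\<^sub>v(1, x) = I(1, m)\<^sup>1\<^sup>-\<^sup>v I(m, x)\<^sup>v\<close>, so that the classical bounds of \<open>L\<close> and \<open>I\<close> by the
  geometric and arithmetic means apply.  These bounds coincide at \<open>x = 1\<close>, which also gives the
  continuity of \<open>L\<^sub>v(1, x)\<close> and \<open>I\<^sub>v(1, x)\<close> there.

  The functional calculus rests on \<open>\<parallel>p(T)\<parallel> \<le> sup \<bar>p\<bar>\<close> over the real spectrum: for
  \<open>N = \<parallel>p(T)\<parallel>\<close> the operator \<open>N\<^sup>2 - p(T)\<^sup>2\<close> is not invertible, so \<open>N\<^sup>2 - p\<^sup>2\<close> has a zero on the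
  spectrum.
\<close>

text \<open>The space of bounded operators is complete when the values lie in a
  \<open>banach\<close> space; the limits of the functional calculus rest on this.\<close>

instance complex_hilbert_space \<subseteq> banach ..

section \<open>Bounded and self-adjoint operators\<close>

text \<open>Conjugate linearity in the second argument turns the imaginary part into a real inner
  product with \<open>i y\<close>, so later arguments can stay with \<open>inner\<close>.\<close>

lemma cinner_conv_inner:
  "cinner x y = Complex (inner x y) (inner x (\<i> *\<^sub>C y))" for x :: "'a::complex_hilbert_space"
proof -
  have "cinner x (\<i> *\<^sub>C y) = - \<i> * cinner x y"
    by (metis cinner_commute cinner_scaleC_left complex_cnj_i complex_cnj_mult)
  then show ?thesis
    by (simp add: inner_conv_cinner complex_eq_iff)
qed

text \<open>Complex linearity moves the factor \<open>i\<close> through \<open>T\<close>, so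
  symmetry of the real parts entails that of the imaginary parts.\<close>

lemma selfadjoint_op_iff:
  "selfadjoint_op T \<longleftrightarrow>
    T \<in> bounded_operators \<and> (\<forall>x y. inner (blinfun_apply T x) y = inner x (blinfun_apply T y))"
  unfolding selfadjoint_op_def
  by (auto simp: cinner_conv_inner bounded_operators_def)

lemma positive_op_iff:
  "positive_op T \<longleftrightarrow> selfadjoint_op T \<and> (\<forall>x. 0 \<le> inner (blinfun_apply T x) x)"
  by (simp add: positive_op_def inner_conv_cinner)

lemma selfadjoint_inner:
  "selfadjoint_op T \<Longrightarrow> inner (blinfun_apply T x) y = inner x (blinfun_apply T y)"
  by (simp add: selfadjoint_op_iff)

lemma selfadjoint_bounded_operators: "selfadjoint_op T \<Longrightarrow> T \<in> bounded_operators"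
  by (simp add: selfadjoint_op_def)

lemma scaleC_scaleR: "c *\<^sub>C (r *\<^sub>R x) = r *\<^sub>R (c *\<^sub>C x)" for x :: "'a::complex_hilbert_space"
  by (simp add: scaleR_conv_scaleC scaleC_scaleC mult.commute)

lemma scaleC_diff_right: "c *\<^sub>C (x - y) = c *\<^sub>C x - c *\<^sub>C y" for x :: "'a::complex_hilbert_space"
  by (metis add_diff_cancel diff_add_cancel scaleC_add_right)

lemma bounded_operators_id: "id_blinfun \<in> bounded_operators"
  by (simp add: bounded_operators_def)

lemma bounded_operators_0: "0 \<in> bounded_operators"
  by (auto simp: bounded_operators_def scaleC_diff_right[of _ 0 0, simplified])

lemma bounded_operators_add:
  "S \<in> bounded_operators \<Longrightarrow> T \<in> bounded_operators \<Longrightarrow> S + T \<in> bounded_operators"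
  by (simp add: bounded_operators_def blinfun.add_left scaleC_add_right)

lemma bounded_operators_diff:
  "S \<in> bounded_operators \<Longrightarrow> T \<in> bounded_operators \<Longrightarrow> S - T \<in> bounded_operators"
  by (simp add: bounded_operators_def blinfun.diff_left scaleC_diff_right)

lemma bounded_operators_scaleR: "T \<in> bounded_operators \<Longrightarrow> r *\<^sub>R T \<in> bounded_operators"
  by (simp add: bounded_operators_def blinfun.scaleR_left scaleC_scaleR)

lemma bounded_operators_compose:
  "S \<in> bounded_operators \<Longrightarrow> T \<in> bounded_operators \<Longrightarrow> S o\<^sub>L T \<in> bounded_operators"
  by (simp add: bounded_operators_def)

lemma blinfun_compose_assoc: "(R o\<^sub>L S) o\<^sub>L T = R o\<^sub>L (S o\<^sub>L T)"
  by (rule blinfun_eqI) simp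

lemma blinfun_compose_id [simp]: "id_blinfun o\<^sub>L T = T" "T o\<^sub>L id_blinfun = T"
  by (rule blinfun_eqI, simp)+

lemmas blinfun_compose_simps =
  bounded_bilinear.add_left[OF bounded_bilinear_blinfun_compose]
  bounded_bilinear.add_right[OF bounded_bilinear_blinfun_compose]
  bounded_bilinear.diff_left[OF bounded_bilinear_blinfun_compose]
  bounded_bilinear.diff_right[OF bounded_bilinear_blinfun_compose]
  bounded_bilinear.scaleR_left[OF bounded_bilinear_blinfun_compose]
  bounded_bilinear.scaleR_right[OF bounded_bilinear_blinfun_compose]

lemma selfadjoint_op_id: "selfadjoint_op id_blinfun"
  by (simp add: selfadjoint_op_iff bounded_operators_id)

lemma selfadjoint_op_0: "selfadjoint_op 0"
  by (simp add: selfadjoint_op_iff bounded_operators_0)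

lemma selfadjoint_op_add: "selfadjoint_op S \<Longrightarrow> selfadjoint_op T \<Longrightarrow> selfadjoint_op (S + T)"
  by (simp add: selfadjoint_op_iff bounded_operators_add blinfun.add_left inner_add_left inner_add_right)

lemma selfadjoint_op_diff: "selfadjoint_op S \<Longrightarrow> selfadjoint_op T \<Longrightarrow> selfadjoint_op (S - T)"
  by (simp add: selfadjoint_op_iff bounded_operators_diff blinfun.diff_left inner_diff_left inner_diff_right)

lemma selfadjoint_op_scaleR: "selfadjoint_op T \<Longrightarrow> selfadjoint_op (r *\<^sub>R T)"
  by (simp add: selfadjoint_op_iff bounded_operators_scaleR blinfun.scaleR_left)

lemma selfadjoint_op_compose:
  assumes "selfadjoint_op S" "selfadjoint_op T" "S o\<^sub>L T = T o\<^sub>L S"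
  shows "selfadjoint_op (S o\<^sub>L T)"
proof -
  have "inner ((S o\<^sub>L T) x) y = inner x ((T o\<^sub>L S) y)" for x y
    using assms(1,2) by (simp add: selfadjoint_inner)
  with assms show ?thesis
    by (metis selfadjoint_op_iff bounded_operators_compose)
qed

lemma selfadjoint_op_conj:
  assumes "selfadjoint_op S" "selfadjoint_op T"
  shows "selfadjoint_op (S o\<^sub>L T o\<^sub>L S)"
  using assms by (simp add: selfadjoint_op_iff bounded_operators_compose)

lemma positive_op_conj:
  assumes "selfadjoint_op S" "positive_op T"
  shows "positive_op (S o\<^sub>L T o\<^sub>L S)"
proof -
  have "inner ((S o\<^sub>L T o\<^sub>L S) x) x = inner (T (S x)) (S x)" for x
    using assms(1) by (simp add: selfadjoint_inner)
  with assms show ?thesis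
    by (simp add: positive_op_iff selfadjoint_op_conj)
qed

lemma selfadjoint_op_limit:
  assumes lim: "X \<longlonglongrightarrow> T" and X: "\<And>n. selfadjoint_op (X n)"
  shows "selfadjoint_op T"
proof -
  have l: "(\<lambda>n. blinfun_apply (X n) x) \<longlonglongrightarrow> blinfun_apply T x" for x
    by (intro tendsto_intros lim)
  have "blinfun_apply T (c *\<^sub>C x) = c *\<^sub>C blinfun_apply T x" for c x
  proof (rule LIMSEQ_unique[OF l])
    have "(\<lambda>n. c *\<^sub>C blinfun_apply (X n) x) \<longlonglongrightarrow> c *\<^sub>C blinfun_apply T x"
      by (intro bounded_linear.tendsto[OF bounded_linear_scaleC] l)
    then show "(\<lambda>n. blinfun_apply (X n) (c *\<^sub>C x)) \<longlonglongrightarrow> c *\<^sub>C blinfun_apply T x"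
      using X by (simp add: selfadjoint_op_def bounded_operators_def)
  qed
  moreover have "inner (blinfun_apply T x) y = inner x (blinfun_apply T y)" for x y
  proof (rule LIMSEQ_unique)
    show "(\<lambda>n. inner (blinfun_apply (X n) x) y) \<longlonglongrightarrow> inner (blinfun_apply T x) y"
      by (intro tendsto_intros l)
    show "(\<lambda>n. inner (blinfun_apply (X n) x) y) \<longlonglongrightarrow> inner x (blinfun_apply T y)"
      unfolding selfadjoint_inner[OF X] by (intro tendsto_intros l)
  qed
  ultimately show ?thesis
    by (simp add: selfadjoint_op_iff bounded_operators_def)
qed

section \<open>Invertibility\<close>

lemma invertible_op_compose:
  assumes "invertible_op S" "invertible_op T"
  shows "invertible_op (S o\<^sub>L T)"
proof -
  obtain S' T' where S': "S' \<in> bounded_operators" "S' o\<^sub>L S = id_blinfun" "S o\<^sub>L S' = id_blinfun"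
    and T': "T' \<in> bounded_operators" "T' o\<^sub>L T = id_blinfun" "T o\<^sub>L T' = id_blinfun"
    using assms by (auto simp: invertible_op_def)
  have "(T' o\<^sub>L S') o\<^sub>L (S o\<^sub>L T) = T' o\<^sub>L (S' o\<^sub>L S) o\<^sub>L T"
       "(S o\<^sub>L T) o\<^sub>L (T' o\<^sub>L S') = S o\<^sub>L (T o\<^sub>L T') o\<^sub>L S'"
    by (simp_all only: blinfun_compose_assoc)
  then show ?thesis
    unfolding invertible_op_def using S' T' by (auto intro: bounded_operators_compose)
qed

text \<open>If \<open>R\<close> inverts the commuting product, then \<open>R T\<close> is a left
  inverse and \<open>T R\<close> a right inverse of \<open>S\<close>, and the two must
  coincide.\<close>

lemma invertible_op_factor:
  assumes "invertible_op (S o\<^sub>L T)" "S o\<^sub>L T = T o\<^sub>L S"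
    and "S \<in> bounded_operators" "T \<in> bounded_operators"
  shows "invertible_op S"
proof -
  obtain R where R: "R \<in> bounded_operators" "R o\<^sub>L (S o\<^sub>L T) = id_blinfun" "(S o\<^sub>L T) o\<^sub>L R = id_blinfun"
    using assms(1) by (auto simp: invertible_op_def)
  have r: "S o\<^sub>L (T o\<^sub>L R) = id_blinfun"
    using R by (simp add: blinfun_compose_assoc)
  have l: "(R o\<^sub>L T) o\<^sub>L S = id_blinfun"
    using R assms(2) by (simp add: blinfun_compose_assoc)
  have "R o\<^sub>L T = (R o\<^sub>L T) o\<^sub>L (S o\<^sub>L (T o\<^sub>L R))"
    using r by simp
  also have "\<dots> = T o\<^sub>L R"
    using l by (metis blinfun_compose_assoc blinfun_compose_id(1))
  finally show ?thesis
    using l r R assms unfolding invertible_op_def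
    by (intro bexI[of _ "T o\<^sub>L R"]) (auto intro: bounded_operators_compose)
qed

lemma invertible_op_scaleR:
  assumes "invertible_op T" "r \<noteq> 0"
  shows "invertible_op (r *\<^sub>R T)"
proof -
  obtain S where "S \<in> bounded_operators" "S o\<^sub>L T = id_blinfun" "T o\<^sub>L S = id_blinfun"
    using assms by (auto simp: invertible_op_def)
  then show ?thesis
    using assms(2) unfolding invertible_op_def
    by (intro bexI[of _ "inverse r *\<^sub>R S"]) (auto simp: blinfun_compose_simps bounded_operators_scaleR)
qed

lemma invertible_op_id: "invertible_op id_blinfun"
  unfolding invertible_op_def using bounded_operators_id by auto

text \<open>
  For small \<open>t > 0\<close> the map \<open>x \<mapsto> x - t (T x - y)\<close> is a contraction, and its fixed point solves
  \<open>T x = y\<close>.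
\<close>

lemma coercive_imp_invertible:
  fixes T :: "'a::complex_hilbert_space \<Rightarrow>\<^sub>L 'a"
  assumes T: "T \<in> bounded_operators" and c: "0 < c"
    and coercive: "\<And>x. c * (norm x)\<^sup>2 \<le> inner (blinfun_apply T x) x"
  shows "invertible_op T"
proof -
  \<comment> \<open>The step \<open>t\<close> minimises \<open>1 - 2 t c + t^2 K^2\<close>, and the
    minimum is \<open>q^2\<close>. Adding \<open>c\<close> to the norm makes \<open>K\<close>
    positive and at least \<open>c\<close>, so the radicand of \<open>q\<close> is
    nonnegative.\<close>
  define K where "K = norm T + c"
  define t where "t = c / K\<^sup>2"
  have K: "K > 0" "c \<le> K" "norm T \<le> K"
    using c by (auto simp: K_def intro: add_nonneg_pos)
  have t: "t > 0"
    using c K by (simp add: t_def)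
  define q where "q = sqrt (1 - c\<^sup>2 / K\<^sup>2)"
  have q_arg: "0 \<le> 1 - c\<^sup>2 / K\<^sup>2" "1 - c\<^sup>2 / K\<^sup>2 < 1"
    using c K by (auto simp: divide_simps power_mono)
  then have q: "0 \<le> q" "q < 1"
    by (simp_all add: q_def)
  have contr: "norm (z - t *\<^sub>R blinfun_apply T z) \<le> q * norm z" for z
  proof -
    have nT: "(norm (blinfun_apply T z))\<^sup>2 \<le> K\<^sup>2 * (norm z)\<^sup>2"
      using norm_blinfun[of T z] K by (metis mult_right_mono norm_ge_zero order_trans power_mono power_mult_distrib)
    have "(norm (z - t *\<^sub>R blinfun_apply T z))\<^sup>2 =
        (norm z)\<^sup>2 - 2 * t * inner (blinfun_apply T z) z + t\<^sup>2 * (norm (blinfun_apply T z))\<^sup>2"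
      by (simp only: power2_norm_eq_inner inner_diff_left inner_diff_right inner_scaleR_left
          inner_scaleR_right inner_commute[of z "blinfun_apply T z"])
        (simp add: power2_eq_square algebra_simps)
    also have "\<dots> \<le> (norm z)\<^sup>2 - 2 * t * (c * (norm z)\<^sup>2) + t\<^sup>2 * (K\<^sup>2 * (norm z)\<^sup>2)"
      using t nT coercive[of z] by (intro add_mono diff_mono mult_left_mono) auto
    also have "\<dots> = (1 - c\<^sup>2 / K\<^sup>2) * (norm z)\<^sup>2"
      using K by (simp add: t_def field_simps power2_eq_square)
    also have "\<dots> = (q * norm z)\<^sup>2"
      using q_arg by (simp add: q_def power_mult_distrib)
    finally show ?thesis
      by (rule power2_le_imp_le) (use q in auto)
  qed
  have "\<exists>!x. x - t *\<^sub>R (blinfun_apply T x - y) = x" for y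
  proof (rule banach_fix_type[OF q], intro allI)
    fix x x'
    have "x - t *\<^sub>R (blinfun_apply T x - y) - (x' - t *\<^sub>R (blinfun_apply T x' - y)) =
        (x - x') - t *\<^sub>R blinfun_apply T (x - x')"
      by (simp add: blinfun.diff_right algebra_simps)
    then show "dist (x - t *\<^sub>R (blinfun_apply T x - y)) (x' - t *\<^sub>R (blinfun_apply T x' - y)) \<le> q * dist x x'"
      unfolding dist_norm using contr[of "x - x'"] by (simp only:)
  qed
  then have ex1: "\<exists>!x. blinfun_apply T x = y" for y
    using t by simp
  define g where "g y = (THE x. blinfun_apply T x = y)" for y
  have Tg: "blinfun_apply T (g y) = y" for y
    unfolding g_def by (rule theI'[OF ex1])
  have gT: "g (blinfun_apply T x) = x" for x
    using ex1 Tg by metis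
  have bound: "norm (g y) \<le> norm y * (1 / c)" for y
  proof -
    have "c * (norm (g y))\<^sup>2 \<le> norm y * norm (g y)"
      using coercive[of "g y"] norm_cauchy_schwarz[of y "g y"] Tg[of y] by simp
    then have "c * norm (g y) \<le> norm y" if "norm (g y) > 0"
      using that by (simp add: power2_eq_square)
    then show ?thesis
      using c by (cases "norm (g y) > 0") (auto simp: field_simps)
  qed
  have lin: "bounded_linear g"
  proof (rule bounded_linear_intro[where K = "1 / c"])
    show "g (x + y) = g x + g y" for x y
      using gT[of "g x + g y"] by (simp add: blinfun.add_right Tg)
    show "g (r *\<^sub>R x) = r *\<^sub>R g x" for r x
      using gT[of "r *\<^sub>R g x"] by (simp add: blinfun.scaleR_right Tg)
  qed (rule bound)
  have "g (a *\<^sub>C x) = a *\<^sub>C g x" for a x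
    using gT[of "a *\<^sub>C g x"] T by (simp add: bounded_operators_def Tg)
  then show ?thesis
    unfolding invertible_op_def
    by (intro bexI[of _ "Blinfun g"])
      (auto intro!: blinfun_eqI simp: bounded_linear_Blinfun_apply[OF lin] gT Tg bounded_operators_def)
qed

lemma invertible_imp_bounded_below:
  assumes "invertible_op T"
  shows "\<exists>c>0. \<forall>x. c * norm x \<le> norm (blinfun_apply T x)"
proof -
  obtain S where S: "S o\<^sub>L T = id_blinfun"
    using assms by (auto simp: invertible_op_def)
  \<comment> \<open>The summand 1 keeps the constant positive on the zero space, where
    \<open>norm S\<close> is 0.\<close>
  have pos: "0 < norm S + 1"
    by (intro add_nonneg_pos) auto
  have "norm x \<le> (norm S + 1) * norm (blinfun_apply T x)" for x
  proof -
    have "x = blinfun_apply S (blinfun_apply T x)"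
      using S by (metis blinfun_apply_blinfun_compose blinfun_apply_id_blinfun id_apply)
    then have "norm x \<le> norm S * norm (blinfun_apply T x)"
      by (metis norm_blinfun)
    also have "\<dots> \<le> (norm S + 1) * norm (blinfun_apply T x)"
      by (simp add: mult_right_mono)
    finally show ?thesis .
  qed
  then show ?thesis
    using pos by (intro exI[of _ "1 / (norm S + 1)"]) (auto simp: field_simps)
qed

text \<open>As \<open>inner (T (T x)) x = (norm (T x))^2\<close>, the lower bound is coercivity of
  the square of \<open>T\<close>; invertibility then passes to the factor.\<close>

lemma bounded_below_imp_invertible:
  assumes T: "selfadjoint_op T" and c: "0 < c"
    and below: "\<And>x. c * norm x \<le> norm (blinfun_apply T x)"
  shows "invertible_op T"
proof (rule invertible_op_factor[where T = T])
  have TB: "T \<in> bounded_operators"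
    by (rule selfadjoint_bounded_operators[OF T])
  show "invertible_op (T o\<^sub>L T)"
  proof (rule coercive_imp_invertible)
    show "c\<^sup>2 * (norm x)\<^sup>2 \<le> inner (blinfun_apply (T o\<^sub>L T) x) x" for x
      using power_mono[OF below[of x], of 2] c T
      by (simp add: power_mult_distrib selfadjoint_inner power2_norm_eq_inner)
  qed (use c TB in \<open>auto intro: bounded_operators_compose\<close>)
qed (use T in \<open>auto simp: selfadjoint_op_def\<close>)

section \<open>The real spectrum\<close>

text \<open>Only real points are recorded because \<open>cfc\<close> tests convergence only at
  these.\<close>

definition real_spectrum :: "('a::complex_hilbert_space \<Rightarrow>\<^sub>L 'a) \<Rightarrow> real set"
  where "real_spectrum T = {x. \<not> invertible_op (T - x *\<^sub>R id_blinfun)}"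

lemma real_spectrum_eq: "{x. complex_of_real x \<in> op_spectrum T} = real_spectrum T"
  for T :: "'a::complex_hilbert_space \<Rightarrow>\<^sub>L 'a"
proof -
  have "scalar_op (complex_of_real x) = x *\<^sub>R (id_blinfun :: 'a \<Rightarrow>\<^sub>L 'a)" for x
    by (rule blinfun_eqI) (simp add: scalar_op.rep_eq scaleR_conv_scaleC blinfun.scaleR_left)
  then show ?thesis
    by (simp add: op_spectrum_def real_spectrum_def)
qed

lemma selfadjoint_shift: "selfadjoint_op T \<Longrightarrow> selfadjoint_op (T - x *\<^sub>R id_blinfun)"
  by (intro selfadjoint_op_diff selfadjoint_op_scaleR selfadjoint_op_id)

text \<open>For \<open>x\<close> beyond \<open>norm T\<close> in absolute value the triangle
  inequality bounds \<open>T - x\<close> from below. A lower bound \<open>c\<close> at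
  \<open>x\<close> becomes \<open>c - dist y x\<close> at a nearby \<open>y\<close>, so the
  complement is open. Compactness is what polynomial approximation requires.\<close>

lemma compact_real_spectrum:
  fixes T :: "'a::complex_hilbert_space \<Rightarrow>\<^sub>L 'a"
  assumes T: "selfadjoint_op T"
  shows "compact (real_spectrum T)"
  unfolding compact_eq_bounded_closed
proof
  have "\<bar>x\<bar> \<le> norm T" if "x \<in> real_spectrum T" for x
  proof (rule ccontr)
    assume less: "\<not> \<bar>x\<bar> \<le> norm T"
    have "invertible_op (T - x *\<^sub>R id_blinfun)"
    proof (rule bounded_below_imp_invertible[where c = "\<bar>x\<bar> - norm T"])
      fix u
      have "norm (x *\<^sub>R u) - norm (blinfun_apply T u) \<le> norm (blinfun_apply T u - x *\<^sub>R u)"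
        by (metis norm_minus_commute norm_triangle_ineq2)
      moreover have "norm (blinfun_apply T u) \<le> norm T * norm u"
        by (rule norm_blinfun)
      ultimately show "(\<bar>x\<bar> - norm T) * norm u \<le> norm (blinfun_apply (T - x *\<^sub>R id_blinfun) u)"
        by (simp add: blinfun.diff_left blinfun.scaleR_left algebra_simps)
    qed (use less T in \<open>auto intro: selfadjoint_shift\<close>)
    with that show False
      by (simp add: real_spectrum_def)
  qed
  then show "bounded (real_spectrum T)"
    by (auto simp: bounded_iff)
  have "\<exists>e>0. \<forall>y. dist y x < e \<longrightarrow> y \<in> - real_spectrum T" if "x \<in> - real_spectrum T" for x
  proof -
    have "invertible_op (T - x *\<^sub>R id_blinfun)"
      using that by (simp add: real_spectrum_def)
    then obtain c where c: "0 < c" "\<And>u. c * norm u \<le> norm (blinfun_apply (T - x *\<^sub>R id_blinfun) u)"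
      using invertible_imp_bounded_below by blast
    have "invertible_op (T - y *\<^sub>R id_blinfun)" if y: "dist y x < c" for y
    proof (rule bounded_below_imp_invertible[where c = "c - dist y x"])
      fix u
      have "(T - y *\<^sub>R id_blinfun) u = (T - x *\<^sub>R id_blinfun) u - (y - x) *\<^sub>R u"
        by (simp add: blinfun.diff_left blinfun.scaleR_left algebra_simps)
      then have "norm ((T - x *\<^sub>R id_blinfun) u) - norm ((y - x) *\<^sub>R u) \<le> norm ((T - y *\<^sub>R id_blinfun) u)"
        by (metis norm_triangle_ineq2)
      with c(2)[of u] show "(c - dist y x) * norm u \<le> norm ((T - y *\<^sub>R id_blinfun) u)"
        by (simp add: dist_real_def left_diff_distrib)
    qed (use y T in \<open>auto intro: selfadjoint_shift\<close>)
    with c show ?thesis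
      by (auto simp: real_spectrum_def)
  qed
  then show "closed (real_spectrum T)"
    unfolding closed_def open_dist by blast
qed

section \<open>Polynomials in an operator\<close>

text \<open>The Horner form opens the algebra of \<open>poly_op\<close> to induction on polynomials.
  The case \<open>p = 0\<close> stands apart because there the degree does not grow by one.\<close>

lemma poly_op_pCons: "poly_op (pCons a p) T = a *\<^sub>R id_blinfun + (T o\<^sub>L poly_op p T)"
proof (cases "p = 0")
  case True
  then show ?thesis
    by (cases "a = 0") (simp_all add: poly_op_def op_power_def)
next
  case False
  then have "poly_op (pCons a p) T =
      a *\<^sub>R id_blinfun + (\<Sum>i\<le>degree p. coeff p i *\<^sub>R op_power T (Suc i))"
    by (simp add: poly_op_def sum.atMost_Suc_shift op_power_def del: sum.atMost_Suc)
  also have "(\<Sum>i\<le>degree p. coeff p i *\<^sub>R op_power T (Suc i)) = T o\<^sub>L poly_op p T"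
    by (simp add: poly_op_def op_power_def blinfun_compose_simps
        bounded_bilinear.sum_right[OF bounded_bilinear_blinfun_compose])
  finally show ?thesis .
qed

lemma poly_op_0 [simp]: "poly_op 0 T = 0"
  by (simp add: poly_op_def)

lemma poly_op_const [simp]: "poly_op [:a:] T = a *\<^sub>R id_blinfun"
  by (simp add: poly_op_pCons)

lemma poly_op_X [simp]: "poly_op [:0, 1:] T = T"
  by (simp add: poly_op_pCons)

lemma poly_op_add: "poly_op (p + q) T = poly_op p T + poly_op q T"
proof (induction p arbitrary: q)
  case (pCons a p)
  obtain b q' where "q = pCons b q'"
    using pCons_cases by blast
  then show ?case
    using pCons by (simp add: poly_op_pCons blinfun_compose_simps scaleR_add_left)
qed simp

lemma poly_op_smult: "poly_op (smult c p) T = c *\<^sub>R poly_op p T"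
  by (induction p) (simp_all add: poly_op_pCons blinfun_compose_simps scaleR_add_right)

lemma poly_op_diff: "poly_op (p - q) T = poly_op p T - poly_op q T"
  using poly_op_add[of p "smult (-1) q" T] poly_op_smult[of "-1" q T] by simp

lemma poly_op_mult: "poly_op (p * q) T = poly_op p T o\<^sub>L poly_op q T"
  by (induction p)
    (simp_all add: poly_op_pCons poly_op_add poly_op_smult blinfun_compose_simps blinfun_compose_assoc)

lemma poly_op_commute: "poly_op p T o\<^sub>L poly_op q T = poly_op q T o\<^sub>L poly_op p T"
  by (metis mult.commute poly_op_mult)

lemma selfadjoint_poly_op:
  assumes "selfadjoint_op T"
  shows "selfadjoint_op (poly_op p T)"
proof (induction p)
  case (pCons a p)
  have "selfadjoint_op (T o\<^sub>L poly_op p T)"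
    using selfadjoint_op_compose[OF assms pCons(2)] poly_op_commute[of "[:0, 1:]" T p] by simp
  then show ?case
    by (simp add: poly_op_pCons selfadjoint_op_add selfadjoint_op_scaleR selfadjoint_op_id)
qed (simp add: selfadjoint_op_0)

section \<open>The norm of a polynomial in an operator and the spectrum\<close>

text \<open>The operator is \<open>(T - a)^2 + b^2\<close>, whose first summand is positive, so
  \<open>b^2\<close> is a coercivity constant.\<close>

lemma invertible_quadratic:
  assumes T: "selfadjoint_op T" and b: "b \<noteq> 0"
  shows "invertible_op (poly_op [:a\<^sup>2 + b\<^sup>2, - 2 * a, 1:] T)"
proof (rule coercive_imp_invertible)
  show "poly_op [:a\<^sup>2 + b\<^sup>2, - 2 * a, 1:] T \<in> bounded_operators"
    using selfadjoint_poly_op[OF T] by (rule selfadjoint_bounded_operators)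
  show "b\<^sup>2 * (norm x)\<^sup>2 \<le> inner (poly_op [:a\<^sup>2 + b\<^sup>2, - 2 * a, 1:] T x) x" for x
  proof -
    have "inner (poly_op [:a\<^sup>2 + b\<^sup>2, - 2 * a, 1:] T x) x =
        (a\<^sup>2 + b\<^sup>2) * inner x x - 2 * a * inner (T x) x + inner (T x) (T x)"
      using T by (simp add: poly_op_pCons blinfun.add_left blinfun.add_right blinfun.scaleR_left
          blinfun.scaleR_right blinfun.diff_left blinfun.diff_right blinfun.minus_left blinfun.minus_right
          inner_diff_left inner_add_left selfadjoint_inner[OF T])
    also have "\<dots> = b\<^sup>2 * (norm x)\<^sup>2 + (norm (a *\<^sub>R x - T x))\<^sup>2"
      by (simp add: power2_norm_eq_inner inner_diff_left inner_diff_right inner_commute[of x "T x"])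
        (simp add: power2_eq_square algebra_simps)
    finally show ?thesis
      by simp
  qed
qed (use b in simp)

text \<open>The divisor is the product of \<open>X - z\<close> and \<open>X - cnj z\<close>. The
  remainder has degree below 2 and vanishes at the non-real \<open>z\<close>, which forces both of
  its real coefficients to be 0.\<close>

lemma real_poly_quadratic_dvd:
  fixes p :: "real poly"
  assumes root: "poly (map_poly complex_of_real p) z = 0" and z: "Im z \<noteq> 0"
  shows "[:(Re z)\<^sup>2 + (Im z)\<^sup>2, - 2 * Re z, 1:] dvd p"
proof -
  define d where "d = [:(Re z)\<^sup>2 + (Im z)\<^sup>2, - 2 * Re z, 1:]"
  have dz: "poly (map_poly complex_of_real d) z = 0"
    by (simp add: d_def complex_eq_iff power2_eq_square algebra_simps map_poly_pCons)
  have mp: "map_poly complex_of_real (q + r) = map_poly complex_of_real q + map_poly complex_of_real r"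
     "map_poly complex_of_real (q * r) = map_poly complex_of_real q * map_poly complex_of_real r" for q r
    by (auto simp: poly_eq_iff coeff_map_poly coeff_mult)
  define r where "r = p mod d"
  have "p = p div d * d + r"
    by (simp add: r_def)
  then have "poly (map_poly complex_of_real r) z = 0"
    using root dz by (metis add_0 mp mult_zero_right poly_add poly_mult)
  moreover have "degree r < 2"
    using degree_mod_less[of d p] by (auto simp: r_def d_def)
  then obtain r0 r1 where r: "r = [:r0, r1:]"
    by (metis One_nat_def Suc_1 degree_pCons_eq_if less_Suc_eq_le not_less_eq_eq pCons_cases bot_nat_0.extremum_uniqueI degree_eq_zeroE pCons_0_0)
  ultimately have "r = 0"
    using z by (auto simp: complex_eq_iff map_poly_pCons)
  then show ?thesis
    by (simp add: r_def d_def mod_eq_0_iff_dvd)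
qed

text \<open>A complex root of \<open>p\<close> splits off a real factor: linear with its root
  outside the spectrum, or quadratic without real roots. Either is invertible at \<open>T\<close>,
  and induction on the degree treats the cofactor.\<close>

lemma invertible_poly_op:
  assumes T: "selfadjoint_op T"
    and nz: "p \<noteq> 0" "\<And>x. x \<in> real_spectrum T \<Longrightarrow> poly p x \<noteq> 0"
  shows "invertible_op (poly_op p T)"
  using nz
proof (induction "degree p" arbitrary: p rule: less_induct)
  case less
  show ?case
  proof (cases "degree p = 0")
    case True
    then obtain c where "p = [:c:]" "c \<noteq> 0"
      using less.prems by (metis degree_eq_zeroE pCons_0_0)
    then show ?thesis
      by (simp add: invertible_op_scaleR invertible_op_id)
  next
    case False
    then have "degree (map_poly complex_of_real p) \<noteq> 0"
      by (simp add: degree_map_poly)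
    then obtain z where z: "poly (map_poly complex_of_real p) z = 0"
      using fundamental_theorem_of_algebra[of "map_poly complex_of_real p"]
      by (auto simp: constant_degree)
    have step: "invertible_op (poly_op p T)"
      if d: "d dvd p" "degree d > 0" "invertible_op (poly_op d T)" for d
    proof -
      obtain q where q: "p = d * q"
        using d by blast
      with less.prems have "q \<noteq> 0" "d \<noteq> 0" "\<And>x. x \<in> real_spectrum T \<Longrightarrow> poly q x \<noteq> 0"
        by auto
      moreover from this have "degree q < degree p"
        using d q by (simp add: degree_mult_eq)
      ultimately have "invertible_op (poly_op q T)"
        using less.hyps by blast
      with d q show ?thesis
        by (simp add: poly_op_mult invertible_op_compose)
    qed
    show ?thesis
    proof (cases "Im z = 0")
      case True
      then have z_real: "z = complex_of_real (Re z)"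
        by (simp add: complex_eq_iff)
      have "poly (map_poly complex_of_real p) (complex_of_real (Re z)) = complex_of_real (poly p (Re z))"
        by (induction p) (simp_all add: map_poly_pCons)
      with z z_real have root: "poly p (Re z) = 0"
        by (metis of_real_eq_0_iff)
      with less.prems have "invertible_op (T - Re z *\<^sub>R id_blinfun)"
        by (auto simp: real_spectrum_def)
      then have "invertible_op (poly_op [:- Re z, 1:] T)"
        by (simp add: poly_op_pCons)
      with root show ?thesis
        by (intro step[of "[:- Re z, 1:]"]) (auto simp: poly_eq_0_iff_dvd)
    next
      case False
      show ?thesis
        using invertible_quadratic[OF T False, of "Re z"] real_poly_quadratic_dvd[OF z False]
        by (intro step[of "[:(Re z)\<^sup>2 + (Im z)\<^sup>2, - 2 * Re z, 1:]"]) auto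
    qed
  qed
qed

text \<open>
  Along unit vectors on which \<open>S\<close> almost attains its norm, \<open>S\<^sup>2 - \<parallel>S\<parallel>\<^sup>2\<close> tends to \<open>0\<close>.
\<close>

lemma norm_square_not_invertible:
  assumes S: "selfadjoint_op S" and "S \<noteq> 0"
  shows "\<not> invertible_op ((norm S)\<^sup>2 *\<^sub>R id_blinfun - (S o\<^sub>L S))"
proof
  define N where "N = norm S"
  have N: "N > 0"
    using assms by (simp add: N_def)
  assume "invertible_op ((norm S)\<^sup>2 *\<^sub>R id_blinfun - (S o\<^sub>L S))"
  then obtain c where c: "0 < c"
    "\<And>x. c * norm x \<le> norm (((norm S)\<^sup>2 *\<^sub>R id_blinfun - (S o\<^sub>L S)) x)"
    using invertible_imp_bounded_below by blast
  \<comment> \<open>A constant below both \<open>N^2\<close> and \<open>c^2 / N^2\<close>: the first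
    bound keeps \<open>N^2 - k\<close> positive, the second lets \<open>c^2\<close> absorb
    \<open>k N^2\<close> in the estimate.\<close>
  define k where "k = min (c\<^sup>2 / (2 * N\<^sup>2)) (N\<^sup>2 / 2)"
  have k: "0 < k" "k < N\<^sup>2" "k * N\<^sup>2 < c\<^sup>2"
  proof -
    have pos: "0 < c\<^sup>2" "0 < N\<^sup>2"
      using c(1) N by simp_all
    have "k * N\<^sup>2 \<le> c\<^sup>2 / (2 * N\<^sup>2) * N\<^sup>2"
      by (intro mult_right_mono) (simp_all add: k_def)
    also have "\<dots> = c\<^sup>2 / 2"
      using N by simp
    also have "\<dots> < c\<^sup>2"
      using pos by simp
    finally show "k * N\<^sup>2 < c\<^sup>2" .
    show "0 < k" "k < N\<^sup>2"
      using pos by (simp_all add: k_def min_less_iff_disj)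
  qed
  \<comment> \<open>The argument runs by contraposition: squaring the lower bound for
    \<open>N^2 - S^2\<close> yields a norm bound for \<open>S\<close> strictly below
    \<open>N\<close>.\<close>
  have "norm (S x) \<le> sqrt (N\<^sup>2 - k) * norm x" for x
  proof -
    have Sx: "(norm (S (S x)))\<^sup>2 \<le> N\<^sup>2 * (norm (S x))\<^sup>2"
      using norm_blinfun[of S "S x"] by (metis N_def norm_ge_zero power_mono power_mult_distrib)
    have "c\<^sup>2 * (norm x)\<^sup>2 \<le> (norm (N\<^sup>2 *\<^sub>R x - S (S x)))\<^sup>2"
      using power_mono[OF c(2)[of x], of 2] c(1)
      by (simp add: N_def power_mult_distrib blinfun.diff_left blinfun.scaleR_left)
    also have "\<dots> = N ^ 4 * (norm x)\<^sup>2 - 2 * N\<^sup>2 * (norm (S x))\<^sup>2 + (norm (S (S x)))\<^sup>2"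
      by (simp add: power2_norm_eq_inner inner_diff_left inner_diff_right selfadjoint_inner[OF S]
          inner_commute[of "S (S x)" x])
        (simp add: power2_eq_square power4_eq_xxxx algebra_simps)
    finally have "N\<^sup>2 * (norm (S x))\<^sup>2 \<le> N ^ 4 * (norm x)\<^sup>2 - c\<^sup>2 * (norm x)\<^sup>2"
      using Sx by simp
    also have "\<dots> \<le> N ^ 4 * (norm x)\<^sup>2 - k * N\<^sup>2 * (norm x)\<^sup>2"
      using k by (intro diff_left_mono mult_right_mono) auto
    also have "\<dots> = N\<^sup>2 * ((N\<^sup>2 - k) * (norm x)\<^sup>2)"
      by (simp add: power2_eq_square power4_eq_xxxx algebra_simps)
    finally have "(norm (S x))\<^sup>2 \<le> (N\<^sup>2 - k) * (norm x)\<^sup>2"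
      using N by simp
    also have "\<dots> = (sqrt (N\<^sup>2 - k) * norm x)\<^sup>2"
      using k by (simp add: power_mult_distrib)
    finally show ?thesis
      by (rule power2_le_imp_le) (use k in auto)
  qed
  then have "norm S \<le> sqrt (N\<^sup>2 - k)"
    using k by (intro norm_blinfun_bound) auto
  also have "\<dots> < N"
    using N k real_sqrt_less_mono[of "N\<^sup>2 - k" "N\<^sup>2"] by simp
  finally show False
    by (simp add: N_def)
qed

text \<open>One of \<open>norm T\<close> and \<open>- norm T\<close> lies in the spectrum, since
  otherwise \<open>(norm T)^2 - T^2\<close> would be invertible as a product. The nonzero
  \<open>S\<close> witnesses that the space is not zero; on the zero space every operator is
  invertible.\<close>

lemma real_spectrum_nonempty:
  assumes T: "selfadjoint_op T" and "(S :: 'a::complex_hilbert_space \<Rightarrow>\<^sub>L 'a) \<noteq> 0"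
  shows "real_spectrum (T :: 'a \<Rightarrow>\<^sub>L 'a) \<noteq> {}"
proof
  assume "real_spectrum T = {}"
  then have inv: "invertible_op (T - x *\<^sub>R id_blinfun)" for x
    by (auto simp: real_spectrum_def)
  show False
  proof (cases "T = 0")
    case True
    with inv[of 0] have "(id_blinfun :: 'a \<Rightarrow>\<^sub>L 'a) = 0"
      by (simp add: invertible_op_def)
    then have "S o\<^sub>L id_blinfun = 0"
      by simp
    with assms show False
      by simp
  next
    case False
    have "invertible_op ((T - norm T *\<^sub>R id_blinfun) o\<^sub>L ((-1) *\<^sub>R (T - (- norm T) *\<^sub>R id_blinfun)))"
      by (intro invertible_op_compose invertible_op_scaleR inv) simp
    also have "(T - norm T *\<^sub>R id_blinfun) o\<^sub>L ((-1) *\<^sub>R (T - (- norm T) *\<^sub>R id_blinfun)) =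
        (norm T)\<^sup>2 *\<^sub>R id_blinfun - (T o\<^sub>L T)"
      by (simp only: blinfun_compose_simps blinfun_compose_id)
        (simp add: power2_eq_square algebra_simps)
    finally show False
      using norm_square_not_invertible[OF T False] by contradiction
  qed
qed

lemma norm_poly_op_le:
  assumes T: "selfadjoint_op T" and M: "0 \<le> M" "\<And>x. x \<in> real_spectrum T \<Longrightarrow> \<bar>poly p x\<bar> \<le> M"
  shows "norm (poly_op p T) \<le> M"
proof (rule ccontr)
  assume "\<not> norm (poly_op p T) \<le> M"
  then have less: "M < norm (poly_op p T)"
    by simp
  define N where "N = norm (poly_op p T)"
  define q where "q = [:N\<^sup>2:] - p * p"
  have N: "M < N" "N > 0"
    using less M(1) by (simp_all only: N_def)
  have qT: "poly_op q T = N\<^sup>2 *\<^sub>R id_blinfun - (poly_op p T o\<^sub>L poly_op p T)"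
    by (simp add: q_def poly_op_diff poly_op_mult)
  have nz: "poly q x \<noteq> 0" if "x \<in> real_spectrum T" for x
  proof -
    have "\<bar>poly p x\<bar>\<^sup>2 \<le> M\<^sup>2"
      by (rule power_mono[OF M(2)[OF that]]) simp
    moreover have "M\<^sup>2 < N\<^sup>2"
      by (rule power_strict_mono[OF N(1) M(1)]) simp
    ultimately show ?thesis
      by (simp add: q_def power2_eq_square)
  qed
  have ne: "poly_op p T \<noteq> 0"
    using N(2) unfolding N_def by simp
  \<comment> \<open>The values of \<open>q\<close> are known to be nonzero only on the spectrum, so
    a point of it is what excludes \<open>q = 0\<close>.\<close>
  then have "real_spectrum T \<noteq> {}"
    by (rule real_spectrum_nonempty[OF T])
  with nz have "q \<noteq> 0"
    by auto
  with nz have "invertible_op (poly_op q T)"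
    by (intro invertible_poly_op[OF T])
  moreover have "\<not> invertible_op (poly_op q T)"
    unfolding qT N_def by (rule norm_square_not_invertible[OF selfadjoint_poly_op[OF T] ne])
  ultimately show False
    by contradiction
qed

section \<open>Continuous functional calculus\<close>

lemma uniform_limit_realI:
  fixes f :: "nat \<Rightarrow> 'b \<Rightarrow> real"
  assumes "\<And>n x. x \<in> S \<Longrightarrow> \<bar>f n x - g x\<bar> \<le> inverse (real (Suc n))"
  shows "uniform_limit S f g sequentially"
proof (rule uniform_limitI)
  fix e :: real
  assume "e > 0"
  then have "\<forall>\<^sub>F n in sequentially. inverse (real (Suc n)) < e"
    using LIMSEQ_inverse_real_of_nat by (rule order_tendstoD(2)[rotated])
  then show "\<forall>\<^sub>F n in sequentially. \<forall>x\<in>S. dist (f n x) (g x) < e"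
    by eventually_elim (use assms le_less_trans in \<open>unfold dist_real_def, blast\<close>)
qed

lemma poly_approximation:
  fixes f :: "real \<Rightarrow> real"
  assumes "compact S" "continuous_on S f"
  obtains p where "uniform_limit S (\<lambda>n. poly (p n)) f sequentially"
proof -
  have "\<exists>p. \<forall>x\<in>S. \<bar>poly p x - f x\<bar> \<le> inverse (real (Suc n))" for n
  proof -
    obtain g where g: "real_polynomial_function g" "\<And>x. x \<in> S \<Longrightarrow> \<bar>f x - g x\<bar> < inverse (real (Suc n))"
      using Stone_Weierstrass_real_polynomial_function[OF assms, of "inverse (real (Suc n))"] by auto
    obtain a m where a: "g = (\<lambda>x. \<Sum>i\<le>m. a i * x ^ i)"
      using g(1) real_polynomial_function_iff_sum by blast
    have "poly (\<Sum>i\<le>m. monom (a i) i) x = g x" for x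
      by (simp add: a poly_sum poly_monom)
    with g(2) show ?thesis
      by (intro exI[of _ "\<Sum>i\<le>m. monom (a i) i"]) (force simp: abs_minus_commute)
  qed
  then obtain p where "\<And>n. \<forall>x\<in>S. \<bar>poly (p n) x - f x\<bar> \<le> inverse (real (Suc n))"
    by metis
  then have "uniform_limit S (\<lambda>n. poly (p n)) f sequentially"
    by (intro uniform_limit_realI) auto
  then show thesis ..
qed

text \<open>This makes the limit in \<open>cfc\<close> independent of the approximating sequence:
  \<open>norm_poly_op_le\<close> turns uniform closeness on the spectrum into closeness in operator
  norm.\<close>

lemma poly_op_diff_tendsto_0:
  assumes T: "selfadjoint_op T"
    and p: "uniform_limit (real_spectrum T) (\<lambda>n. poly (p n)) f sequentially"
    and q: "uniform_limit (real_spectrum T) (\<lambda>n. poly (q n)) f sequentially"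
  shows "(\<lambda>n. poly_op (p n) T - poly_op (q n) T) \<longlonglongrightarrow> 0"
proof (rule tendstoI)
  fix e :: real
  assume e: "e > 0"
  have "uniform_limit (real_spectrum T) (\<lambda>n x. poly (p n) x - poly (q n) x) (\<lambda>x. f x - f x) sequentially"
    by (intro uniform_limit_intros p q)
  then have "\<forall>\<^sub>F n in sequentially. \<forall>x\<in>real_spectrum T. dist (poly (p n) x - poly (q n) x) (f x - f x) < e / 2"
    using e by (intro uniform_limitD) auto
  then show "\<forall>\<^sub>F n in sequentially. dist (poly_op (p n) T - poly_op (q n) T) 0 < e"
  proof eventually_elim
    case (elim n)
    have "norm (poly_op (p n - q n) T) \<le> e / 2"
      using e elim by (intro norm_poly_op_le T) (auto intro: less_imp_le)
    then show ?case
      using e by (simp add: poly_op_diff)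
  qed
qed

text \<open>One approximating sequence whose operators converge settles the definite description in
  \<open>cfc\<close>, any other such sequence having the same limit.\<close>

lemma cfcI:
  assumes T: "selfadjoint_op T"
    and p: "uniform_limit (real_spectrum T) (\<lambda>n. poly (p n)) f sequentially"
    and lim: "(\<lambda>n. poly_op (p n) T) \<longlonglongrightarrow> S"
  shows "cfc f T = S"
  unfolding cfc_def real_spectrum_eq
proof (rule the_equality)
  fix S'
  assume "\<exists>q. uniform_limit (real_spectrum T) (\<lambda>n. poly (q n)) f sequentially \<and>
    (\<lambda>n. poly_op (q n) T) \<longlonglongrightarrow> S'"
  then obtain q where q: "uniform_limit (real_spectrum T) (\<lambda>n. poly (q n)) f sequentially"
    "(\<lambda>n. poly_op (q n) T) \<longlonglongrightarrow> S'"
    by blast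
  have "(\<lambda>n. poly_op (p n) T - poly_op (q n) T) \<longlonglongrightarrow> S - S'"
    by (intro tendsto_intros lim q)
  then have "S - S' = 0"
    using poly_op_diff_tendsto_0[OF T p q(1)] LIMSEQ_unique by blast
  then show "S' = S"
    by simp
qed (use p lim in blast)

text \<open>Uniform convergence makes the operators a Cauchy sequence by
  \<open>norm_poly_op_le\<close>, and the operator space is complete.\<close>

lemma cfc_limit:
  assumes T: "selfadjoint_op T"
    and f: "continuous_on (real_spectrum T) f"
    and p: "uniform_limit (real_spectrum T) (\<lambda>n. poly (p n)) f sequentially"
  shows "(\<lambda>n. poly_op (p n) T) \<longlonglongrightarrow> cfc f T"
proof -
  have "Cauchy (\<lambda>n. poly_op (p n) T)"
  proof (rule metric_CauchyI)
    fix e :: real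
    assume e: "e > 0"
    then have "\<forall>\<^sub>F n in sequentially. \<forall>x\<in>real_spectrum T. dist (poly (p n) x) (f x) < e / 4"
      by (intro uniform_limitD[OF p]) auto
    then obtain N where N: "\<And>n x. n \<ge> N \<Longrightarrow> x \<in> real_spectrum T \<Longrightarrow> dist (poly (p n) x) (f x) < e / 4"
      by (auto simp: eventually_sequentially)
    have "dist (poly_op (p m) T) (poly_op (p n) T) < e" if "m \<ge> N" "n \<ge> N" for m n
    proof -
      have "norm (poly_op (p m - p n) T) \<le> e / 2"
      proof (rule norm_poly_op_le[OF T])
        fix x
        assume "x \<in> real_spectrum T"
        with N[of m x] N[of n x] that show "\<bar>poly (p m - p n) x\<bar> \<le> e / 2"
          by (simp add: dist_real_def abs_if split: if_splits)
      qed (use e in simp)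
      with e show ?thesis
        by (simp add: dist_norm poly_op_diff)
    qed
    then show "\<exists>M. \<forall>m\<ge>M. \<forall>n\<ge>M. dist (poly_op (p m) T) (poly_op (p n) T) < e"
      by blast
  qed
  then obtain S where "(\<lambda>n. poly_op (p n) T) \<longlonglongrightarrow> S"
    using Cauchy_convergent convergent_def by blast
  with cfcI[OF T p this] show ?thesis
    by simp
qed

lemma cfcE:
  assumes T: "selfadjoint_op T" and f: "continuous_on (real_spectrum T) f"
  obtains p where "uniform_limit (real_spectrum T) (\<lambda>n. poly (p n)) f sequentially"
    "(\<lambda>n. poly_op (p n) T) \<longlonglongrightarrow> cfc f T"
  using poly_approximation[OF compact_real_spectrum[OF T] f] cfc_limit[OF T f] by metis

lemma cfc_cong:
  assumes "\<And>x. x \<in> real_spectrum T \<Longrightarrow> f x = g x"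
  shows "cfc f T = cfc g T"
proof -
  have "uniform_limit (real_spectrum T) p f sequentially = uniform_limit (real_spectrum T) p g sequentially"
    for p :: "nat \<Rightarrow> real \<Rightarrow> real"
    using assms by (intro uniform_limit_cong') auto
  then show ?thesis
    by (simp add: cfc_def real_spectrum_eq)
qed

lemma cfc_poly: "selfadjoint_op T \<Longrightarrow> cfc (poly p) T = poly_op p T"
  by (rule cfcI[where p = "\<lambda>_. p"]) (auto intro: uniform_limit_const)

lemma cfc_const: "selfadjoint_op T \<Longrightarrow> cfc (\<lambda>x. c) T = c *\<^sub>R id_blinfun"
  using cfc_poly[of T "[:c:]"] cfc_cong[of T "poly [:c:]" "\<lambda>x. c"] by simp

lemma cfc_ident: "selfadjoint_op T \<Longrightarrow> cfc (\<lambda>x. x) T = T"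
  using cfc_poly[of T "[:0, 1:]"] cfc_cong[of T "poly [:0, 1:]" "\<lambda>x. x"] by simp

lemma cfc_add:
  assumes T: "selfadjoint_op T"
    and f: "continuous_on (real_spectrum T) f" and g: "continuous_on (real_spectrum T) g"
  shows "cfc (\<lambda>x. f x + g x) T = cfc f T + cfc g T"
proof -
  obtain p where p: "uniform_limit (real_spectrum T) (\<lambda>n. poly (p n)) f sequentially"
    "(\<lambda>n. poly_op (p n) T) \<longlonglongrightarrow> cfc f T"
    by (rule cfcE[OF T f])
  obtain q where q: "uniform_limit (real_spectrum T) (\<lambda>n. poly (q n)) g sequentially"
    "(\<lambda>n. poly_op (q n) T) \<longlonglongrightarrow> cfc g T"
    by (rule cfcE[OF T g])
  show ?thesis
  proof (rule cfcI[OF T, where p = "\<lambda>n. p n + q n"])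
    show "uniform_limit (real_spectrum T) (\<lambda>n. poly (p n + q n)) (\<lambda>x. f x + g x) sequentially"
      using uniform_limit_add[OF p(1) q(1)] by (simp add: poly_add[abs_def])
  qed (simp add: poly_op_add p q tendsto_add)
qed

lemma cfc_mult:
  assumes T: "selfadjoint_op T"
    and f: "continuous_on (real_spectrum T) f" and g: "continuous_on (real_spectrum T) g"
  shows "cfc (\<lambda>x. f x * g x) T = cfc f T o\<^sub>L cfc g T"
proof -
  obtain p where p: "uniform_limit (real_spectrum T) (\<lambda>n. poly (p n)) f sequentially"
    "(\<lambda>n. poly_op (p n) T) \<longlonglongrightarrow> cfc f T"
    by (rule cfcE[OF T f])
  obtain q where q: "uniform_limit (real_spectrum T) (\<lambda>n. poly (q n)) g sequentially"
    "(\<lambda>n. poly_op (q n) T) \<longlonglongrightarrow> cfc g T"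
    by (rule cfcE[OF T g])
  have bdd: "bounded (f ` real_spectrum T)" "bounded (g ` real_spectrum T)"
    using compact_continuous_image[OF f] compact_continuous_image[OF g] compact_real_spectrum[OF T]
    by (auto intro: compact_imp_bounded)
  show ?thesis
  proof (rule cfcI[OF T, where p = "\<lambda>n. p n * q n"])
    show "uniform_limit (real_spectrum T) (\<lambda>n. poly (p n * q n)) (\<lambda>x. f x * g x) sequentially"
      using uniform_lim_mult[OF p(1) q(1) bdd] by (simp add: poly_mult[abs_def])
    show "(\<lambda>n. poly_op (p n * q n) T) \<longlonglongrightarrow> (cfc f T o\<^sub>L cfc g T)"
      unfolding poly_op_mult
      by (intro bounded_bilinear.tendsto[OF bounded_bilinear_blinfun_compose] p q)
  qed
qed

lemma cfc_scaleR:
  assumes "selfadjoint_op T" "continuous_on (real_spectrum T) f"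
  shows "cfc (\<lambda>x. c * f x) T = c *\<^sub>R cfc f T"
  using cfc_mult[OF assms(1) continuous_on_const assms(2), of c] assms(1)
  by (simp add: cfc_const blinfun_compose_simps)

lemma selfadjoint_cfc:
  assumes "selfadjoint_op T" "continuous_on (real_spectrum T) f"
  shows "selfadjoint_op (cfc f T)"
  by (rule cfcE[OF assms]) (rule selfadjoint_op_limit, assumption, rule selfadjoint_poly_op[OF assms(1)])

text \<open>Multiplicativity exhibits the operator as the square of the self-adjoint operator
  obtained from \<open>sqrt (f x)\<close>.\<close>

lemma cfc_nonneg:
  assumes T: "selfadjoint_op T" and f: "continuous_on (real_spectrum T) f"
    and nn: "\<And>x. x \<in> real_spectrum T \<Longrightarrow> 0 \<le> f x"
  shows "positive_op (cfc f T)"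
proof -
  define g where "g = cfc (\<lambda>x. sqrt (f x)) T"
  have cont: "continuous_on (real_spectrum T) (\<lambda>x. sqrt (f x))"
    by (intro continuous_intros f)
  have g: "selfadjoint_op g"
    unfolding g_def by (rule selfadjoint_cfc[OF T cont])
  have "cfc f T = cfc (\<lambda>x. sqrt (f x) * sqrt (f x)) T"
    using nn by (intro cfc_cong) simp
  also have "\<dots> = g o\<^sub>L g"
    unfolding g_def by (rule cfc_mult[OF T cont cont])
  finally show ?thesis
    using selfadjoint_cfc[OF T f] selfadjoint_inner[OF g, of "g x" x for x]
    by (simp add: positive_op_iff)
qed

lemma cfc_mono:
  assumes T: "selfadjoint_op T"
    and f: "continuous_on (real_spectrum T) f" and g: "continuous_on (real_spectrum T) g"
    and le: "\<And>x. x \<in> real_spectrum T \<Longrightarrow> f x \<le> g x"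
  shows "cfc f T \<preceq> cfc g T"
proof -
  have "cfc (\<lambda>x. g x + (-1) * f x) T = cfc g T + (-1) *\<^sub>R cfc f T"
    using cfc_add[OF T g, of "\<lambda>x. (-1) * f x"] cfc_scaleR[OF T f, of "-1"] f
    by (simp add: continuous_on_minus)
  moreover have "positive_op (cfc (\<lambda>x. g x + (-1) * f x) T)"
    using le by (intro cfc_nonneg T continuous_intros f g) simp
  ultimately show ?thesis
    by (simp add: op_le_def)
qed

text \<open>Approximating polynomials are eventually bounded by \<open>M + e\<close> on the
  spectrum; \<open>norm_poly_op_le\<close> applies to them and the bound survives the limit.\<close>

lemma norm_cfc_le:
  assumes T: "selfadjoint_op T" and f: "continuous_on (real_spectrum T) f"
    and M: "0 \<le> M" "\<And>x. x \<in> real_spectrum T \<Longrightarrow> \<bar>f x\<bar> \<le> M"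
  shows "norm (cfc f T) \<le> M"
proof (rule field_le_epsilon)
  fix e :: real
  assume e: "e > 0"
  obtain p where p: "uniform_limit (real_spectrum T) (\<lambda>n. poly (p n)) f sequentially"
    "(\<lambda>n. poly_op (p n) T) \<longlonglongrightarrow> cfc f T"
    by (rule cfcE[OF T f])
  have "\<forall>\<^sub>F n in sequentially. norm (poly_op (p n) T) \<le> M + e"
    using uniform_limitD[OF p(1) e]
  proof eventually_elim
    case (elim n)
    have "\<bar>poly (p n) x\<bar> \<le> M + e" if "x \<in> real_spectrum T" for x
      using M(2)[OF that] bspec[OF elim that] by (auto simp: dist_real_def)
    then show ?case
      using e M(1) by (intro norm_poly_op_le T) auto
  qed
  then show "norm (cfc f T) \<le> M + e"
    by (rule tendsto_upperbound[OF tendsto_norm[OF p(2)]]) simp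
qed

section \<open>Spectral inclusion, composition and similarity\<close>

text \<open>For \<open>y\<close> outside the image, \<open>1 / (f x - y)\<close> is continuous on
  the spectrum, and its operator inverts \<open>cfc f T - y\<close>.\<close>

lemma real_spectrum_cfc:
  assumes T: "selfadjoint_op T" and f: "continuous_on (real_spectrum T) f"
  shows "real_spectrum (cfc f T) \<subseteq> f ` real_spectrum T"
proof (rule subsetI, rule ccontr)
  fix y
  assume y: "y \<in> real_spectrum (cfc f T)" and "y \<notin> f ` real_spectrum T"
  then have ne: "f x - y \<noteq> 0" if "x \<in> real_spectrum T" for x
    using that by auto
  define g where "g = (\<lambda>x. inverse (f x - y))"
  have contf: "continuous_on (real_spectrum T) (\<lambda>x. f x - y)"
    by (intro continuous_intros f)
  have contg: "continuous_on (real_spectrum T) g"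
    unfolding g_def using ne by (intro continuous_intros f) auto
  have "cfc (\<lambda>x. f x - y) T = cfc f T - y *\<^sub>R id_blinfun"
    using cfc_add[OF T f continuous_on_const, of "- y"] cfc_const[OF T, of "-y"] by simp
  moreover have "cfc (\<lambda>x. f x - y) T o\<^sub>L cfc g T = id_blinfun" "cfc g T o\<^sub>L cfc (\<lambda>x. f x - y) T = id_blinfun"
  proof -
    have "cfc (\<lambda>x. (f x - y) * g x) T = cfc (\<lambda>x. 1) T" "cfc (\<lambda>x. g x * (f x - y)) T = cfc (\<lambda>x. 1) T"
      using ne by (auto simp: g_def intro!: cfc_cong)
    then show "cfc (\<lambda>x. f x - y) T o\<^sub>L cfc g T = id_blinfun" "cfc g T o\<^sub>L cfc (\<lambda>x. f x - y) T = id_blinfun"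
      using cfc_mult[OF T contf contg] cfc_mult[OF T contg contf] cfc_const[OF T, of 1] by simp_all
  qed
  ultimately have "invertible_op (cfc f T - y *\<^sub>R id_blinfun)"
    using selfadjoint_cfc[OF T contg]
    unfolding invertible_op_def by (intro bexI[of _ "cfc g T"]) (auto simp: selfadjoint_op_def)
  with y show False
    by (simp add: real_spectrum_def)
qed

text \<open>For polynomial \<open>g\<close> this is additivity and multiplicativity of
  \<open>cfc\<close>. Polynomials approximating \<open>g\<close> on the image of the spectrum also
  do so on the spectrum of \<open>cfc f T\<close>, and \<open>norm_cfc_le\<close> passes to the
  limit.\<close>

lemma cfc_compose:
  assumes T: "selfadjoint_op T" and f: "continuous_on (real_spectrum T) f"
    and g: "continuous_on (f ` real_spectrum T) g"
  shows "cfc g (cfc f T) = cfc (\<lambda>x. g (f x)) T"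
proof -
  obtain p where p: "uniform_limit (f ` real_spectrum T) (\<lambda>n. poly (p n)) g sequentially"
    using poly_approximation[OF compact_continuous_image[OF f compact_real_spectrum[OF T]] g] by blast
  have cont_poly: "continuous_on (real_spectrum T) (\<lambda>x. poly q (f x))" for q
    by (intro continuous_intros f)
  have cont_gf: "continuous_on (real_spectrum T) (\<lambda>x. g (f x))"
    using continuous_on_compose[OF f g] by (simp add: o_def)
  have poly_cfc: "poly_op q (cfc f T) = cfc (\<lambda>x. poly q (f x)) T" for q
  proof (induction q)
    case 0
    then show ?case
      using cfc_const[OF T, of 0] by simp
  next
    case (pCons a q)
    have "cfc (\<lambda>x. a + f x * poly q (f x)) T = a *\<^sub>R id_blinfun + (cfc f T o\<^sub>L cfc (\<lambda>x. poly q (f x)) T)"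
      using cfc_add[OF T continuous_on_const, of "\<lambda>x. f x * poly q (f x)" a]
        cfc_mult[OF T f cont_poly, of q] continuous_on_mult[OF f cont_poly, of q] cfc_const[OF T, of a]
      by simp
    then show ?case
      using pCons.IH by (simp add: poly_op_pCons)
  qed
  show ?thesis
  proof (rule cfcI[OF selfadjoint_cfc[OF T f]])
    show "uniform_limit (real_spectrum (cfc f T)) (\<lambda>n. poly (p n)) g sequentially"
      by (rule uniform_limit_on_subset[OF p real_spectrum_cfc[OF T f]])
    show "(\<lambda>n. poly_op (p n) (cfc f T)) \<longlonglongrightarrow> cfc (\<lambda>x. g (f x)) T"
      unfolding poly_cfc
    proof (rule tendstoI)
      fix e :: real
      assume e: "e > 0"
      then have "\<forall>\<^sub>F n in sequentially. \<forall>x\<in>f ` real_spectrum T. dist (poly (p n) x) (g x) < e / 2"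
        by (intro uniform_limitD[OF p]) auto
      then show "\<forall>\<^sub>F n in sequentially. dist (cfc (\<lambda>x. poly (p n) (f x)) T) (cfc (\<lambda>x. g (f x)) T) < e"
      proof eventually_elim
        case (elim n)
        have "norm (cfc (\<lambda>x. poly (p n) (f x) + (-1) * g (f x)) T) \<le> e / 2"
          using e elim by (intro norm_cfc_le T continuous_intros f cont_gf)
            (auto simp: dist_real_def intro!: less_imp_le)
        moreover have "cfc (\<lambda>x. poly (p n) (f x) + (-1) * g (f x)) T =
            cfc (\<lambda>x. poly (p n) (f x)) T + (-1) *\<^sub>R cfc (\<lambda>x. g (f x)) T"
          using cfc_add[OF T cont_poly continuous_on_mult[OF continuous_on_const cont_gf]]
            cfc_scaleR[OF T cont_gf] by metis
        ultimately show ?case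
          using e by (simp add: dist_norm)
      qed
    qed
  qed
qed

text \<open>Conjugation commutes with polynomials and preserves invertibility of
  \<open>T - x\<close>, so polynomials approximating \<open>f\<close> for \<open>T\<close> serve the
  conjugated operator too.\<close>

lemma cfc_similar:
  assumes T: "selfadjoint_op T" and STS: "selfadjoint_op (S o\<^sub>L T o\<^sub>L S')"
    and f: "continuous_on (real_spectrum T) f"
    and S: "S o\<^sub>L S' = id_blinfun" "S' o\<^sub>L S = id_blinfun" "S \<in> bounded_operators" "S' \<in> bounded_operators"
  shows "cfc f (S o\<^sub>L T o\<^sub>L S') = S o\<^sub>L cfc f T o\<^sub>L S'"
proof -
  have SS: "S (S' x) = x" "S' (S x) = x" for x
    using S(1,2) by (metis blinfun_apply_blinfun_compose blinfun_apply_id_blinfun id_apply)+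
  have inv: "invertible_op S" "invertible_op S'"
    using S unfolding invertible_op_def by auto
  have sub: "real_spectrum (S o\<^sub>L T o\<^sub>L S') \<subseteq> real_spectrum T"
  proof -
    have "invertible_op ((S o\<^sub>L T o\<^sub>L S') - x *\<^sub>R id_blinfun)" if "invertible_op (T - x *\<^sub>R id_blinfun)" for x
    proof -
      have "(S o\<^sub>L T o\<^sub>L S') - x *\<^sub>R id_blinfun = S o\<^sub>L (T - x *\<^sub>R id_blinfun) o\<^sub>L S'"
        by (rule blinfun_eqI) (simp add: blinfun.bilinear_simps SS)
      with that inv show ?thesis
        by (simp add: invertible_op_compose)
    qed
    then show ?thesis
      by (auto simp: real_spectrum_def)
  qed
  have poly: "poly_op p (S o\<^sub>L T o\<^sub>L S') = S o\<^sub>L poly_op p T o\<^sub>L S'" for p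
  proof (induction p)
    case (pCons a p)
    then show ?case
      by (intro blinfun_eqI)
        (simp add: poly_op_pCons blinfun.add_left blinfun.add_right blinfun.scaleR_left blinfun.scaleR_right SS)
  qed simp
  obtain p where p: "uniform_limit (real_spectrum T) (\<lambda>n. poly (p n)) f sequentially"
    "(\<lambda>n. poly_op (p n) T) \<longlonglongrightarrow> cfc f T"
    by (rule cfcE[OF T f])
  show ?thesis
  proof (rule cfcI[OF STS uniform_limit_on_subset[OF p(1) sub]])
    show "(\<lambda>n. poly_op (p n) (S o\<^sub>L T o\<^sub>L S')) \<longlonglongrightarrow> (S o\<^sub>L cfc f T o\<^sub>L S')"
      unfolding poly
      by (intro bounded_bilinear.tendsto[OF bounded_bilinear_blinfun_compose] tendsto_const p)
  qed
qed

section \<open>Positive invertible operators and their means\<close>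

text \<open>For \<open>x < 0\<close> positivity makes \<open>A - x\<close> coercive with constant
  \<open>- x\<close>, and invertibility excludes 0. Conversely \<open>cfc_nonneg\<close> applies to
  the identity function. In this form, continuity of functions on the positive reals suffices for
  the calculus.\<close>

lemma positive_invertible_ops_iff:
  "A \<in> positive_invertible_ops \<longleftrightarrow> selfadjoint_op A \<and> real_spectrum A \<subseteq> {0<..}"
proof
  assume "A \<in> positive_invertible_ops"
  then have pos: "positive_op A" and inv: "invertible_op A"
    by (auto simp: positive_invertible_ops_def)
  then have A: "selfadjoint_op A"
    by (simp add: positive_op_iff)
  have "x > 0" if x: "x \<in> real_spectrum A" for x
  proof (rule ccontr)
    assume "\<not> x > 0"
    with x inv have neg: "x < 0"
      by (cases "x = 0") (auto simp: real_spectrum_def)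
    have "invertible_op (A - x *\<^sub>R id_blinfun)"
    proof (rule coercive_imp_invertible)
      show "- x * (norm u)\<^sup>2 \<le> inner (blinfun_apply (A - x *\<^sub>R id_blinfun) u) u" for u
        using pos by (simp add: positive_op_iff blinfun.diff_left blinfun.scaleR_left inner_diff_left
            power2_norm_eq_inner)
    qed (use A neg in \<open>auto intro: selfadjoint_bounded_operators selfadjoint_shift\<close>)
    with x show False
      by (simp add: real_spectrum_def)
  qed
  with A show "selfadjoint_op A \<and> real_spectrum A \<subseteq> {0<..}"
    by auto
next
  assume A: "selfadjoint_op A \<and> real_spectrum A \<subseteq> {0<..}"
  then have "positive_op (cfc (\<lambda>x. x) A)"
    by (intro cfc_nonneg) (auto intro: less_imp_le)
  moreover have "invertible_op A"
    using A by (auto simp: real_spectrum_def dest: subsetD[of _ _ 0])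
  ultimately show "A \<in> positive_invertible_ops"
    using A by (simp add: positive_invertible_ops_def cfc_ident)
qed

lemma cfc_positive_invertible:
  assumes "selfadjoint_op T" "continuous_on (real_spectrum T) f" "\<And>x. x \<in> real_spectrum T \<Longrightarrow> 0 < f x"
  shows "cfc f T \<in> positive_invertible_ops"
  using selfadjoint_cfc[OF assms(1,2)] real_spectrum_cfc[OF assms(1,2)] assms(3)
  by (force simp: positive_invertible_ops_iff)

lemma continuous_on_real_spectrum:
  fixes f :: "real \<Rightarrow> real"
  assumes "A \<in> positive_invertible_ops" "continuous_on {0<..} f"
  shows "continuous_on (real_spectrum A) f"
  using assms continuous_on_subset by (auto simp: positive_invertible_ops_iff)

lemma continuous_on_powr_pos: "continuous_on {0<..} (\<lambda>x::real. x powr r)"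
  by (intro continuous_intros) auto

lemma positive_invertible_selfadjoint: "A \<in> positive_invertible_ops \<Longrightarrow> selfadjoint_op A"
  by (simp add: positive_invertible_ops_iff)

lemma op_powr_positive_invertible:
  assumes "A \<in> positive_invertible_ops"
  shows "op_powr A r \<in> positive_invertible_ops"
  unfolding op_powr_def using assms
  by (intro cfc_positive_invertible continuous_on_real_spectrum continuous_on_powr_pos)
    (auto simp: positive_invertible_ops_iff)

lemma selfadjoint_op_powr: "A \<in> positive_invertible_ops \<Longrightarrow> selfadjoint_op (op_powr A r)"
  by (intro positive_invertible_selfadjoint op_powr_positive_invertible)

lemma op_powr_add:
  assumes A: "A \<in> positive_invertible_ops"
  shows "op_powr A (r + s) = op_powr A r o\<^sub>L op_powr A s"
  unfolding op_powr_def powr_add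
  by (intro cfc_mult positive_invertible_selfadjoint continuous_on_real_spectrum continuous_on_powr_pos A)

lemma op_powr_1: "A \<in> positive_invertible_ops \<Longrightarrow> op_powr A 1 = A"
  using cfc_cong[of A "\<lambda>x. x powr 1" "\<lambda>x. x"] cfc_ident[of A]
  by (force simp: op_powr_def positive_invertible_ops_iff)

text \<open>Positivity of the spectrum matters because \<open>0 powr 0 = 0\<close>.\<close>

lemma op_powr_0: "A \<in> positive_invertible_ops \<Longrightarrow> op_powr A 0 = id_blinfun"
  using cfc_cong[of A "\<lambda>x. x powr 0" "\<lambda>x. 1"] cfc_const[of A 1]
  by (force simp: op_powr_def positive_invertible_ops_iff)

text \<open>In pointwise form, adjacent roots cancel inside nested applications without any
  reassociation of compositions.\<close>

lemma op_powr_half_apply: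
  assumes "A \<in> positive_invertible_ops"
  shows "op_powr A (1/2) (op_powr A (- (1/2)) x) = x" "op_powr A (- (1/2)) (op_powr A (1/2) x) = x"
    "op_powr A (1/2) (op_powr A (1/2) x) = A x"
  using op_powr_add[OF assms, of "1/2" "- (1/2)"] op_powr_add[OF assms, of "- (1/2)" "1/2"]
    op_powr_add[OF assms, of "1/2" "1/2"] op_powr_0[OF assms] op_powr_1[OF assms]
  by (simp_all flip: blinfun_apply_blinfun_compose)

lemma positive_invertible_conj:
  assumes A: "A \<in> positive_invertible_ops" and S: "selfadjoint_op S" "invertible_op S"
  shows "S o\<^sub>L A o\<^sub>L S \<in> positive_invertible_ops"
  using assms by (auto simp: positive_invertible_ops_def intro: invertible_op_compose positive_op_conj)

lemma invertible_op_powr: "A \<in> positive_invertible_ops \<Longrightarrow> invertible_op (op_powr A r)"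
  using op_powr_positive_invertible[of A r] by (simp add: positive_invertible_ops_def)

lemma ratio_positive_invertible:
  assumes "A \<in> positive_invertible_ops" "B \<in> positive_invertible_ops"
  shows "op_powr A r o\<^sub>L B o\<^sub>L op_powr A r \<in> positive_invertible_ops"
  using assms by (intro positive_invertible_conj selfadjoint_op_powr invertible_op_powr)

section \<open>Order, algebra and congruence of operator means\<close>

lemma op_mean_mono:
  assumes A: "A \<in> positive_invertible_ops" and B: "B \<in> positive_invertible_ops"
    and f: "continuous_on {0<..} f" and g: "continuous_on {0<..} g"
    and le: "\<And>x. 0 < x \<Longrightarrow> f x \<le> g x"
  shows "op_mean f A B \<preceq> op_mean g A B"
proof -
  define T where "T = op_powr A (-1/2) o\<^sub>L B o\<^sub>L op_powr A (-1/2)"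
  have T: "T \<in> positive_invertible_ops"
    unfolding T_def by (rule ratio_positive_invertible[OF A B])
  have "cfc f T \<preceq> cfc g T"
    using T le by (intro cfc_mono continuous_on_real_spectrum f g) (auto simp: positive_invertible_ops_iff)
  then have "positive_op (op_powr A (1/2) o\<^sub>L (cfc g T - cfc f T) o\<^sub>L op_powr A (1/2))"
    by (intro positive_op_conj selfadjoint_op_powr A) (simp add: op_le_def)
  then show ?thesis
    by (simp add: op_le_def op_mean_def blinfun_compose_simps T_def)
qed

lemma op_arith_mean_op_mean:
  assumes A: "A \<in> positive_invertible_ops" and B: "B \<in> positive_invertible_ops"
    and f: "continuous_on {0<..} f" and g: "continuous_on {0<..} g"
  shows "(op_mean f A B) \<nabla>\<^bsub>v\<^esub> (op_mean g A B) = op_mean (\<lambda>x. (1 - v) * f x + v * g x) A B"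
proof -
  define T where "T = op_powr A (-1/2) o\<^sub>L B o\<^sub>L op_powr A (-1/2)"
  have T: "T \<in> positive_invertible_ops" "selfadjoint_op T"
    unfolding T_def using ratio_positive_invertible[OF A B] by (auto simp: positive_invertible_ops_iff)
  note cont = continuous_on_real_spectrum[OF T(1)]
  have "cfc (\<lambda>x. (1 - v) * f x + v * g x) T = (1 - v) *\<^sub>R cfc f T + v *\<^sub>R cfc g T"
    by (simp add: cfc_add cfc_scaleR T cont f g continuous_on_mult_left)
  then show ?thesis
    by (simp add: op_arith_mean_def op_mean_def T_def blinfun_compose_simps)
qed

lemma op_mean_left:
  assumes A: "A \<in> positive_invertible_ops" and B: "B \<in> positive_invertible_ops"
  shows "op_mean (\<lambda>x. 1) A B = A"
  using A positive_invertible_selfadjoint[OF ratio_positive_invertible[OF A B, of "-1/2"]]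
  by (intro blinfun_eqI) (simp add: op_mean_def cfc_const op_powr_half_apply)

lemma op_mean_right:
  assumes A: "A \<in> positive_invertible_ops" and B: "B \<in> positive_invertible_ops"
  shows "op_mean (\<lambda>x. x) A B = B"
  using A positive_invertible_selfadjoint[OF ratio_positive_invertible[OF A B, of "-1/2"]]
  by (intro blinfun_eqI) (simp add: op_mean_def cfc_ident op_powr_half_apply)

lemma op_arith_mean_eq:
  assumes A: "A \<in> positive_invertible_ops" and B: "B \<in> positive_invertible_ops"
  shows "A \<nabla>\<^bsub>v\<^esub> B = op_mean (\<lambda>x. 1 - v + v * x) A B"
  using op_arith_mean_op_mean[OF A B, of "\<lambda>x. 1" "\<lambda>x. x" v] op_mean_left[OF A B] op_mean_right[OF A B]
  by simp

text \<open>
  With \<open>X = C A C\<close>, the operator \<open>S = X\<^sup>-\<^sup>1\<^sup>/\<^sup>2 C A\<^sup>1\<^sup>/\<^sup>2\<close> is unitary with adjoint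
  \<open>S' = A\<^sup>1\<^sup>/\<^sup>2 C X\<^sup>-\<^sup>1\<^sup>/\<^sup>2\<close>, and it conjugates \<open>A\<^sup>-\<^sup>1\<^sup>/\<^sup>2 B A\<^sup>-\<^sup>1\<^sup>/\<^sup>2\<close> into
  \<open>X\<^sup>-\<^sup>1\<^sup>/\<^sup>2 (C B C) X\<^sup>-\<^sup>1\<^sup>/\<^sup>2\<close>.
\<close>

lemma op_mean_congruence:
  assumes A: "A \<in> positive_invertible_ops" and B: "B \<in> positive_invertible_ops"
    and C: "selfadjoint_op C" "invertible_op C"
    and f: "continuous_on {0<..} f"
  shows "op_mean f (C o\<^sub>L A o\<^sub>L C) (C o\<^sub>L B o\<^sub>L C) = C o\<^sub>L op_mean f A B o\<^sub>L C"
proof -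
  define X where "X = C o\<^sub>L A o\<^sub>L C"
  have X: "X \<in> positive_invertible_ops"
    unfolding X_def by (rule positive_invertible_conj[OF A C])
  define Z where "Z = op_powr A (-1/2) o\<^sub>L B o\<^sub>L op_powr A (-1/2)"
  have Z: "Z \<in> positive_invertible_ops"
    unfolding Z_def by (rule ratio_positive_invertible[OF A B])
  define S where "S = op_powr X (-1/2) o\<^sub>L C o\<^sub>L op_powr A (1/2)"
  define S' where "S' = op_powr A (1/2) o\<^sub>L C o\<^sub>L op_powr X (-1/2)"
  note A_half = op_powr_half_apply[OF A] and X_half = op_powr_half_apply[OF X]
  have CB: "C \<in> bounded_operators"
    by (rule selfadjoint_bounded_operators[OF C(1)])
  have SB: "S \<in> bounded_operators" "S' \<in> bounded_operators"
    unfolding S_def S'_def using A X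
    by (auto intro!: bounded_operators_compose CB selfadjoint_bounded_operators[OF selfadjoint_op_powr])
  have "invertible_op S"
    unfolding S_def by (intro invertible_op_compose invertible_op_powr A X C)
  then obtain R where R: "R o\<^sub>L S = id_blinfun"
    by (auto simp: invertible_op_def)
  have SS': "S o\<^sub>L S' = id_blinfun"
  proof (rule blinfun_eqI)
    fix x
    have "(S o\<^sub>L S') x = op_powr X (-1/2) (X (op_powr X (-1/2) x))"
      by (simp add: S_def S'_def A_half X_def)
    also have "\<dots> = x"
      by (simp add: X_half(1,2) flip: X_half(3))
    finally show "(S o\<^sub>L S') x = id_blinfun x"
      by simp
  qed
  \<comment> \<open>\<open>S\<close> has the left inverse \<open>R\<close> and the right inverse
    \<open>S'\<close>, so these are equal.\<close>
  have "S' = R o\<^sub>L (S o\<^sub>L S')"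
    using R by (metis blinfun_compose_assoc blinfun_compose_id(1))
  then have S'S: "S' o\<^sub>L S = id_blinfun"
    using R SS' by simp
  have ratio: "op_powr X (-1/2) o\<^sub>L (C o\<^sub>L B o\<^sub>L C) o\<^sub>L op_powr X (-1/2) = S o\<^sub>L Z o\<^sub>L S'"
    by (rule blinfun_eqI) (simp add: S_def S'_def Z_def A_half)
  have "selfadjoint_op (S o\<^sub>L Z o\<^sub>L S')"
    unfolding ratio[symmetric]
    by (intro positive_invertible_selfadjoint ratio_positive_invertible positive_invertible_conj X B C)
  then have "cfc f (S o\<^sub>L Z o\<^sub>L S') = S o\<^sub>L cfc f Z o\<^sub>L S'"
    by (intro cfc_similar[OF positive_invertible_selfadjoint[OF Z] _ continuous_on_real_spectrum[OF Z f]]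
        SS' S'S SB)
  then have "op_mean f X (C o\<^sub>L B o\<^sub>L C) = op_powr X (1/2) o\<^sub>L (S o\<^sub>L cfc f Z o\<^sub>L S') o\<^sub>L op_powr X (1/2)"
    unfolding op_mean_def ratio by (rule arg_cong)
  \<comment> \<open>The outer roots of \<open>X\<close> cancel against the inverse roots in
    \<open>S\<close> and \<open>S'\<close>, leaving \<open>C\<close> next to the roots of
    \<open>A\<close>.\<close>
  also have "\<dots> = C o\<^sub>L op_mean f A B o\<^sub>L C"
    by (rule blinfun_eqI) (simp add: S_def S'_def op_mean_def Z_def X_half)
  finally show ?thesis
    by (simp add: X_def)
qed

text \<open>All operators occurring in the definition of the mean are functions of the single
  operator \<open>T\<close>, so it is evaluated pointwise on the spectrum.\<close>

lemma op_geom_mean_cfc: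
  assumes T: "selfadjoint_op T"
    and f: "continuous_on (real_spectrum T) f" "\<And>x. x \<in> real_spectrum T \<Longrightarrow> 0 < f x"
    and g: "continuous_on (real_spectrum T) g" "\<And>x. x \<in> real_spectrum T \<Longrightarrow> 0 < g x"
  shows "(cfc f T) \<sharp>\<^bsub>v\<^esub> (cfc g T) = cfc (\<lambda>x. f x powr (1 - v) * g x powr v) T"
proof -
  have powr: "op_powr (cfc h T) r = cfc (\<lambda>x. h x powr r) T"
    if "continuous_on (real_spectrum T) h" "\<And>x. x \<in> real_spectrum T \<Longrightarrow> 0 < h x" for h r
    unfolding op_powr_def using that(2)
    by (intro cfc_compose T that continuous_on_powr continuous_on_id continuous_on_const) fastforce
  have cont_f: "continuous_on (real_spectrum T) (\<lambda>x. f x powr r)" for r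
    using f by (intro continuous_on_powr continuous_on_const) fastforce+
  \<comment> \<open>On the spectrum this is \<open>g x / f x\<close>, written as three factors to
    mirror the operator product inside the mean.\<close>
  define h where "h = (\<lambda>x. f x powr (-1/2) * g x * f x powr (-1/2))"
  have h: "continuous_on (real_spectrum T) h" "\<And>x. x \<in> real_spectrum T \<Longrightarrow> 0 < h x"
    unfolding h_def using f g by (auto intro!: continuous_on_mult cont_f simp: less_imp_neq[THEN not_sym])
  have cont_h: "continuous_on (real_spectrum T) (\<lambda>x. h x powr v)"
    using h by (intro continuous_on_powr continuous_on_const) fastforce+
  have "op_powr (cfc f T) (-1/2) o\<^sub>L cfc g T o\<^sub>L op_powr (cfc f T) (-1/2) = cfc h T"
    by (simp add: h_def powr f cfc_mult T cont_f g continuous_on_mult)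
  then have "(cfc f T) \<sharp>\<^bsub>v\<^esub> (cfc g T) =
      cfc (\<lambda>x. f x powr (1/2)) T o\<^sub>L cfc (\<lambda>x. h x powr v) T o\<^sub>L cfc (\<lambda>x. f x powr (1/2)) T"
    using powr[OF f, of "1/2"] powr[OF h, of v]
    by (simp add: op_geom_mean_def op_mean_def op_powr_def)
  also have "\<dots> = cfc (\<lambda>x. f x powr (1/2) * h x powr v * f x powr (1/2)) T"
    by (simp add: cfc_mult T cont_f cont_h continuous_on_mult)
  also have "\<dots> = cfc (\<lambda>x. f x powr (1 - v) * g x powr v) T"
  proof (rule cfc_cong)
    fix x
    assume "x \<in> real_spectrum T"
    then have fg: "0 < f x" "0 < g x"
      using f g by auto
    have "f x powr (1/2) * h x powr v * f x powr (1/2) =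
        f x powr (1/2 + (-1/2) * v + (-1/2) * v + 1/2) * g x powr v"
      using fg by (simp only: h_def powr_mult powr_powr powr_add mult_ac powr_ge_zero)
    also have "1/2 + (-1/2) * v + (-1/2) * v + 1/2 = 1 - v"
      by simp
    finally show "f x powr (1/2) * h x powr v * f x powr (1/2) = f x powr (1 - v) * g x powr v" .
  qed
  finally show ?thesis .
qed

text \<open>Both arguments arise from functions of one \<open>T\<close> by congruence with the root
  of \<open>A\<close>. Congruence invariance moves the root outside, which leaves the case of
  \<open>op_geom_mean_cfc\<close>.\<close>

lemma op_geom_mean_op_mean:
  assumes A: "A \<in> positive_invertible_ops" and B: "B \<in> positive_invertible_ops"
    and f: "continuous_on {0<..} f" "\<And>x. 0 < x \<Longrightarrow> 0 < f x"
    and g: "continuous_on {0<..} g" "\<And>x. 0 < x \<Longrightarrow> 0 < g x"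
  shows "(op_mean f A B) \<sharp>\<^bsub>v\<^esub> (op_mean g A B) = op_mean (\<lambda>x. f x powr (1 - v) * g x powr v) A B"
proof -
  define T where "T = op_powr A (-1/2) o\<^sub>L B o\<^sub>L op_powr A (-1/2)"
  have T: "T \<in> positive_invertible_ops" "selfadjoint_op T" "\<And>x. x \<in> real_spectrum T \<Longrightarrow> 0 < x"
    unfolding T_def using ratio_positive_invertible[OF A B] by (auto simp: positive_invertible_ops_iff)
  note cont = continuous_on_real_spectrum[OF T(1)]
  have "(op_mean f A B) \<sharp>\<^bsub>v\<^esub> (op_mean g A B) =
      op_powr A (1/2) o\<^sub>L (cfc f T) \<sharp>\<^bsub>v\<^esub> (cfc g T) o\<^sub>L op_powr A (1/2)"
    unfolding op_geom_mean_def op_mean_def[of f A] op_mean_def[of g A] T_def[symmetric]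
    using T f g by (intro op_mean_congruence cfc_positive_invertible cont selfadjoint_op_powr
        invertible_op_powr continuous_on_powr_pos A) auto
  also have "(cfc f T) \<sharp>\<^bsub>v\<^esub> (cfc g T) = cfc (\<lambda>x. f x powr (1 - v) * g x powr v) T"
    using T f g by (intro op_geom_mean_cfc cont) auto
  finally show ?thesis
    by (simp add: op_mean_def T_def)
qed

section \<open>Scalar means\<close>

text \<open>The difference vanishes at 1 and has derivative \<open>(1 - 1 / t)^2\<close>.\<close>

lemma two_ln_le:
  fixes u :: real
  assumes "1 \<le> u"
  shows "2 * ln u \<le> u - 1 / u"
proof -
  define \<phi> where "\<phi> = (\<lambda>t::real. t - 1 / t - 2 * ln t)"
  have "\<phi> 1 \<le> \<phi> u"
  proof (rule DERIV_nonneg_imp_nondecreasing[OF assms])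
    fix t :: real
    assume "1 \<le> t"
    then have "(\<phi> has_real_derivative (1 - 1 / t)\<^sup>2) (at t)"
      unfolding \<phi>_def by (auto intro!: derivative_eq_intros simp: power2_eq_square field_simps)
    then show "\<exists>y. (\<phi> has_real_derivative y) (at t) \<and> 0 \<le> y"
      by (blast intro: zero_le_power2)
  qed
  then show ?thesis
    by (simp add: \<phi>_def)
qed

text \<open>For \<open>a < b\<close> take \<open>u = sqrt (b / a)\<close> in
  \<open>two_ln_le\<close> and multiply by \<open>a u\<close>, which is the geometric mean. Both
  sides are symmetric in \<open>a\<close> and \<open>b\<close>.\<close>

lemma geometric_le_logarithmic:
  fixes a b :: real
  assumes "0 < a" "0 < b" "a \<noteq> b"
  shows "sqrt (a * b) \<le> (b - a) / (ln b - ln a)"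
proof -
  have less: "sqrt (a * b) \<le> (b - a) / (ln b - ln a)" if ab: "0 < a" "a < b" for a b :: real
  proof -
    define u where "u = sqrt (b / a)"
    have u: "1 \<le> u" "u\<^sup>2 = b / a"
      using ab by (simp_all add: u_def)
    have ln_u: "2 * ln u = ln b - ln a"
      using ab by (simp add: u_def ln_sqrt ln_div)
    have "sqrt (a * b) = a * u"
      using ab u by (intro real_sqrt_unique) (simp_all add: power_mult_distrib, simp add: power2_eq_square)
    then have "sqrt (a * b) * (ln b - ln a) \<le> a * u * (u - 1 / u)"
      using two_ln_le[OF u(1)] ab u(1) ln_u by (simp add: mult_left_mono)
    also have "\<dots> = a * u\<^sup>2 - a"
      using u(1) by (simp add: field_simps power2_eq_square)
    also have "\<dots> = b - a"
      using ab by (simp add: u(2))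
    finally show ?thesis
      using ab by (simp add: le_divide_eq)
  qed
  have "(a - b) / (ln a - ln b) = (b - a) / (ln b - ln a)"
    by (metis minus_diff_eq minus_divide_divide)
  then show ?thesis
    using less[of a b] less[of b a] assms by (auto simp: neq_iff mult.commute)
qed

text \<open>For \<open>a < b\<close> the cleared difference, as a function of the right endpoint
  \<open>t\<close>, vanishes at \<open>a\<close>; its derivative is nonnegative by
  \<open>ln s \<le> s - 1\<close> at \<open>s = a / t\<close>.\<close>

lemma logarithmic_le_arithmetic:
  fixes a b :: real
  assumes "0 < a" "0 < b" "a \<noteq> b"
  shows "(b - a) / (ln b - ln a) \<le> (a + b) / 2"
proof -
  have less: "(b - a) / (ln b - ln a) \<le> (a + b) / 2" if ab: "0 < a" "a < b" for a b :: real
  proof -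
    define \<phi> where "\<phi> = (\<lambda>t. (a + t) * (ln t - ln a) - 2 * (t - a))"
    have "\<phi> a \<le> \<phi> b"
    proof (rule DERIV_nonneg_imp_nondecreasing[where f = \<phi>])
      fix t
      assume t: "a \<le> t"
      have "(\<phi> has_real_derivative (ln t - ln a) + (a / t - 1)) (at t)"
        unfolding \<phi>_def using ab t by (auto intro!: derivative_eq_intros simp: field_simps)
      moreover have "0 \<le> (ln t - ln a) + (a / t - 1)"
        using ln_le_minus_one[of "a / t"] ab t by (simp add: ln_div)
      ultimately show "\<exists>y. (\<phi> has_real_derivative y) (at t) \<and> 0 \<le> y"
        by blast
    qed (use ab in simp)
    then have "2 * (b - a) \<le> (a + b) * (ln b - ln a)"
      by (simp add: \<phi>_def)
    then show ?thesis
      using ab by (simp add: divide_le_eq)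
  qed
  have "(a - b) / (ln a - ln b) = (b - a) / (ln b - ln a)"
    by (metis minus_diff_eq minus_divide_divide)
  then show ?thesis
    using less[of a b] less[of b a] assms by (auto simp: neq_iff add.commute)
qed

text \<open>The right side minus the left is the arithmetic mean divided by the logarithmic mean,
  minus 1.\<close>

lemma ln_geometric_le_ln_identric:
  fixes a b :: real
  assumes "0 < a" "0 < b" "a \<noteq> b"
  shows "(ln a + ln b) / 2 \<le> (b * ln b - a * ln a) / (b - a) - 1"
proof -
  have ne: "ln b \<noteq> ln a"
    using assms by simp
  have pos: "0 < (ln b - ln a) / (b - a)"
    using assms by (auto simp: zero_less_divide_iff neq_iff)
  have "(b - a) / (ln b - ln a) * ((ln b - ln a) / (b - a)) \<le> (a + b) / 2 * ((ln b - ln a) / (b - a))"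
    by (rule mult_right_mono[OF logarithmic_le_arithmetic[OF assms] less_imp_le[OF pos]])
  then have "1 \<le> (a + b) / 2 * ((ln b - ln a) / (b - a))"
    using assms(3) ne by simp
  moreover have "(b * ln b - a * ln a) / (b - a) - (ln a + ln b) / 2 = (a + b) / 2 * ((ln b - ln a) / (b - a))"
    using assms(3) by (simp add: field_simps)
  ultimately show ?thesis
    by linarith
qed

text \<open>
  Integrating the tangent line of \<open>ln\<close> at the midpoint \<open>c\<close> over the interval gives the bound.
\<close>

lemma ln_identric_le_ln_arithmetic:
  fixes a b :: real
  assumes "0 < a" "0 < b" "a \<noteq> b"
  shows "(b * ln b - a * ln a) / (b - a) - 1 \<le> ln ((a + b) / 2)"
proof -
  have less: "(b * ln b - a * ln a) / (b - a) - 1 \<le> ln ((a + b) / 2)" if ab: "0 < a" "a < b" for a b :: real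
  proof -
    define c where "c = (a + b) / 2"
    have c: "c > 0"
      using ab by (simp add: c_def)
    \<comment> \<open>A primitive of the tangent line at \<open>c\<close> minus a primitive of
      \<open>ln\<close>. Since \<open>c\<close> is the midpoint, the quadratic terms at
      \<open>a\<close> and \<open>b\<close> agree and drop out.\<close>
    define \<phi> where "\<phi> = (\<lambda>t. t * ln c + (t - c)\<^sup>2 / (2 * c) - (t * ln t - t))"
    have "\<phi> a \<le> \<phi> b"
    proof (rule DERIV_nonneg_imp_nondecreasing[where f = \<phi>])
      fix t
      assume t: "a \<le> t"
      have "(\<phi> has_real_derivative ln c + (t - c) / c - ln t) (at t)"
        unfolding \<phi>_def using ab t c by (auto intro!: derivative_eq_intros simp: diff_divide_distrib)
      moreover have "0 \<le> ln c + (t - c) / c - ln t"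
        using ln_le_minus_one[of "t / c"] ab t c by (simp add: ln_div diff_divide_distrib)
      ultimately show "\<exists>y. (\<phi> has_real_derivative y) (at t) \<and> 0 \<le> y"
        by blast
    qed (use ab in simp)
    moreover have "(a - c)\<^sup>2 = (b - c)\<^sup>2"
      by (simp add: c_def power2_eq_square field_simps)
    ultimately have "b * ln b - a * ln a \<le> (ln c + 1) * (b - a)"
      by (simp add: \<phi>_def algebra_simps)
    then show ?thesis
      using ab by (simp add: c_def divide_le_eq diff_le_eq)
  qed
  have "(a * ln a - b * ln b) / (a - b) = (b * ln b - a * ln a) / (b - a)"
    by (metis minus_diff_eq minus_divide_divide)
  then show ?thesis
    using less[of a b] less[of b a] assms by (auto simp: neq_iff add.commute)
qed

text \<open>Convexity of \<open>exp\<close> at the points \<open>ln a\<close> and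
  \<open>ln b\<close>.\<close>

lemma weighted_AM_GM:
  fixes a b v :: real
  assumes "0 < a" "0 < b" "0 \<le> v" "v \<le> 1"
  shows "a powr (1 - v) * b powr v \<le> (1 - v) * a + v * b"
proof -
  have "exp ((1 - v) *\<^sub>R ln a + v *\<^sub>R ln b) \<le> (1 - v) * exp (ln a) + v * exp (ln b)"
    using exp_convex assms by (intro convex_onD) auto
  then show ?thesis
    using assms by (simp add: powr_def exp_add)
qed

section \<open>Splitting and bounding the weighted scalar means\<close>

text \<open>The point \<open>x powr v\<close> divides the way from 1 to \<open>x\<close> on the
  logarithmic scale, with log-lengths \<open>v ln x\<close> and \<open>(1 - v) ln x\<close>. The
  term \<open>ln 1\<close> is kept so that the bounds for the unweighted mean match
  literally.\<close>

lemma log_mean_eq: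
  fixes x v :: real
  assumes x: "0 < x" "x \<noteq> 1" and v: "0 < v" "v < 1"
  shows "log_mean v 1 x =
    (1 - v) * ((x powr v - 1) / (ln (x powr v) - ln 1)) + v * ((x - x powr v) / (ln x - ln (x powr v)))"
proof -
  have "ln x \<noteq> 0" "1 - v \<noteq> 0"
    using x v by auto
  then have "ln x - v * ln x \<noteq> 0"
    by (simp add: left_diff_distrib[of 1 v "ln x", simplified, symmetric])
  have "log_mean v 1 x = - (((1 - v) / v * (1 - x powr v) + v / (1 - v) * (x powr v - x)) / ln x)"
    using x v by (simp add: log_mean_def)
  also have "\<dots> = (1 - v) * ((x powr v - 1) / (v * ln x)) + v * ((x - x powr v) / ((1 - v) * ln x))"
    using \<open>ln x \<noteq> 0\<close> \<open>1 - v \<noteq> 0\<close> v(1) by (simp add: divide_simps) (simp add: algebra_simps)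
  also have "(1 - v) * ln x = ln x - ln (x powr v)"
    using x by (simp add: ln_powr algebra_simps)
  finally show ?thesis
    using x by (simp add: ln_powr)
qed

text \<open>Here \<open>m\<close> divides the segment from 1 to \<open>x\<close> into lengths
  \<open>v (x - 1)\<close> and \<open>(1 - v) (x - 1)\<close>. The two terms in
  \<open>m ln m\<close> combine by
  \<open>(1 - v) / v - v / (1 - v) = (1 - 2 v) / (v (1 - v))\<close>, which produces the exponent of
  \<open>m\<close> in the definition.\<close>

lemma identric_mean_eq:
  fixes x v :: real
  assumes x: "0 < x" "x \<noteq> 1" and v: "0 < v" "v < 1"
  defines "m \<equiv> 1 - v + v * x"
  shows "identric_mean v 1 x =
    exp ((1 - v) * ((m * ln m - 1 * ln 1) / (m - 1) - 1) + v * ((x * ln x - m * ln m) / (x - m) - 1))"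
proof -
  have m: "m > 0"
    using x v by (simp add: m_def add_pos_pos)
  define k where "k = x - 1"
  have k: "k \<noteq> 0" "m - 1 = v * k" "x - m = (1 - v) * k" "1 - v \<noteq> 0" "v \<noteq> 0"
    using x v by (auto simp: k_def m_def algebra_simps)
  have "identric_mean v 1 x =
      1 / exp 1 * m powr ((1 - 2 * v) * m / (v * (1 - v) * k)) * (x powr (v * x / (1 - v))) powr (1 / k)"
    using x v by (simp add: identric_mean_def Let_def m_def k_def)
  also have "\<dots> = exp (- 1 + (1 - 2 * v) * m / (v * (1 - v) * k) * ln m + v * x / (1 - v) * (1 / k) * ln x)"
  proof -
    have "1 / exp 1 * m powr a * (x powr b) powr c = exp (- 1 + a * ln m + b * c * ln x)" for a b c
      using x m by (simp add: powr_powr powr_def exp_add exp_diff)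
    then show ?thesis .
  qed
  also have "- 1 + (1 - 2 * v) * m / (v * (1 - v) * k) * ln m + v * x / (1 - v) * (1 / k) * ln x =
      (1 - v) * (m * ln m / (v * k) - 1) + v * ((x * ln x - m * ln m) / ((1 - v) * k) - 1)"
    using k(1,4,5) by (simp add: divide_simps) (simp add: algebra_simps)
  finally show ?thesis
    by (simp add: k)
qed

lemma log_mean_bounds:
  fixes x v :: real
  assumes x: "0 < x" and v: "0 \<le> v" "v \<le> 1"
  shows "(1 - v) * x powr (v/2) + v * x powr ((1+v)/2) \<le> log_mean v 1 x"
    and "log_mean v 1 x \<le> (x powr v + (1 - v + v * x)) / 2"
proof -
  have "(1 - v) * x powr (v/2) + v * x powr ((1+v)/2) \<le> log_mean v 1 x \<and>
      log_mean v 1 x \<le> (x powr v + (1 - v + v * x)) / 2"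
  proof (cases "x = 1 \<or> v = 0 \<or> v = 1")
    \<comment> \<open>At these default values all three members coincide.\<close>
    case True
    then show ?thesis
      using x by (auto simp: log_mean_def)
  next
    case False
    then have v': "0 < v" "v < 1" and x': "x \<noteq> 1"
      using v by auto
    define y where "y = x powr v"
    have y: "0 < y" "1 \<noteq> y" "y \<noteq> x"
      using x x' v' powr_inj[of x v 0] powr_inj[of x v 1] by (auto simp: y_def)
    \<comment> \<open>The geometric midpoints of the two pieces are the source of the weights
      \<open>v/2\<close> and \<open>(1+v)/2\<close>.\<close>
    have sqrt1: "sqrt (1 * y) = x powr (v/2)" and sqrt2: "sqrt (y * x) = x powr ((1+v)/2)"
    proof -
      have "y * x = x powr (1 + v)"
        using x by (simp add: y_def powr_add)
      then show "sqrt (1 * y) = x powr (v/2)" "sqrt (y * x) = x powr ((1+v)/2)"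
        using x y(1) by (simp_all add: y_def powr_powr flip: powr_half_sqrt)
    qed
    note eq = log_mean_eq[OF x x' v', folded y_def]
    have "(1 - v) * sqrt (1 * y) + v * sqrt (y * x) \<le> log_mean v 1 x"
      unfolding eq using v' x y
      by (intro add_mono mult_left_mono geometric_le_logarithmic) auto
    moreover have "log_mean v 1 x \<le> (1 - v) * ((1 + y) / 2) + v * ((y + x) / 2)"
      unfolding eq using v' x y
      by (intro add_mono mult_left_mono logarithmic_le_arithmetic) auto
    moreover have "(1 - v) * ((1 + y) / 2) + v * ((y + x) / 2) = (y + (1 - v + v * x)) / 2"
      by (simp add: field_simps)
    ultimately show ?thesis
      using sqrt1 sqrt2 by (simp add: y_def)
  qed
  then show "(1 - v) * x powr (v/2) + v * x powr ((1+v)/2) \<le> log_mean v 1 x"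
    and "log_mean v 1 x \<le> (x powr v + (1 - v + v * x)) / 2"
    by auto
qed

lemma identric_mean_bounds:
  fixes x v :: real
  assumes x: "0 < x" and v: "0 \<le> v" "v \<le> 1"
  shows "(1 - v + v * x) powr (1/2) * (x powr v) powr (1/2) \<le> identric_mean v 1 x"
    and "identric_mean v 1 x \<le>
      (1 - v/2 + v/2 * x) powr (1 - v) * (1 - (1+v)/2 + (1+v)/2 * x) powr v"
proof -
  have "(1 - v + v * x) powr (1/2) * (x powr v) powr (1/2) \<le> identric_mean v 1 x \<and>
    identric_mean v 1 x \<le> (1 - v/2 + v/2 * x) powr (1 - v) * (1 - (1+v)/2 + (1+v)/2 * x) powr v"
  proof (cases "x = 1 \<or> v = 0 \<or> v = 1")
    case True
    then show ?thesis
      using x by (auto simp: identric_mean_def powr_half_sqrt)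
  next
    case False
    then have v': "0 < v" "v < 1" and x': "x \<noteq> 1"
      using v by auto
    define m where "m = 1 - v + v * x"
    have m: "0 < m"
      using x v' by (simp add: m_def add_pos_pos)
    have "m - 1 = v * (x - 1)" "m - x = (1 - v) * (1 - x)"
      by (simp_all add: m_def algebra_simps)
    with x' v' have ne: "1 \<noteq> m" "m \<noteq> x"
      by auto
    note eq = identric_mean_eq[OF x x' v', folded m_def]
    have "exp ((1 - v) * ((ln 1 + ln m) / 2) + v * ((ln m + ln x) / 2)) \<le> identric_mean v 1 x"
      unfolding eq exp_le_cancel_iff using v' m ne x
      by (intro add_mono mult_left_mono ln_geometric_le_ln_identric) auto
    \<comment> \<open>In the exponent \<open>ln m\<close> collects
      \<open>(1 - v) / 2 + v / 2 = 1 / 2\<close>, whereas \<open>ln x\<close> keeps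
      \<open>v / 2\<close>.\<close>
    moreover have "m powr (1/2) * (x powr v) powr (1/2) =
        exp ((1 - v) * ((ln 1 + ln m) / 2) + v * ((ln m + ln x) / 2))"
      using m x by (simp add: powr_powr powr_def flip: exp_add) (simp add: field_simps)
    moreover have "identric_mean v 1 x \<le> exp ((1 - v) * ln ((1 + m) / 2) + v * ln ((m + x) / 2))"
      unfolding eq exp_le_cancel_iff using v' m ne x
      by (intro add_mono mult_left_mono ln_identric_le_ln_arithmetic) auto
    moreover have "exp ((1 - v) * ln ((1 + m) / 2) + v * ln ((m + x) / 2)) =
        ((1 + m) / 2) powr (1 - v) * ((m + x) / 2) powr v"
      using m x by (simp add: powr_def exp_add)
    \<comment> \<open>The midpoints of the two pieces are again weighted arithmetic means of 1 and
      \<open>x\<close>.\<close>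
    moreover have "(1 + m) / 2 = 1 - v/2 + v/2 * x" "(m + x) / 2 = 1 - (1+v)/2 + (1+v)/2 * x"
      by (simp_all add: m_def field_simps)
    ultimately show ?thesis
      unfolding m_def[symmetric] by (simp only: simp_thms)
  qed
  then show "(1 - v + v * x) powr (1/2) * (x powr v) powr (1/2) \<le> identric_mean v 1 x"
    and "identric_mean v 1 x \<le>
      (1 - v/2 + v/2 * x) powr (1 - v) * (1 - (1+v)/2 + (1+v)/2 * x) powr v"
    by auto
qed

section \<open>Continuity of the weighted scalar means\<close>

text \<open>The formulas for the means divide by \<open>ln x\<close> or \<open>x - 1\<close>, so at
  \<open>c = 1\<close> continuity comes from a squeeze. The bounds also force \<open>f c\<close> to
  be the common value of \<open>l\<close> and \<open>u\<close> there.\<close>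

lemma continuous_on_squeeze_at:
  fixes f l u :: "real \<Rightarrow> real"
  assumes S: "open S" and f: "continuous_on (S - {c}) f"
    and l: "continuous_on S l" and u: "continuous_on S u" and lu: "l c = u c"
    and bounds: "\<And>x. x \<in> S \<Longrightarrow> l x \<le> f x" "\<And>x. x \<in> S \<Longrightarrow> f x \<le> u x"
  shows "continuous_on S f"
proof (rule continuous_at_imp_continuous_on, rule ballI)
  fix x
  assume x: "x \<in> S"
  show "isCont f x"
  proof (cases "x = c")
    case True
    have fx: "f x = l x" "f x = u x"
      using bounds[OF x] lu True by auto
    have ev: "\<forall>\<^sub>F y in at x. y \<in> S"
      using S x by (rule eventually_at_in_open')
    have "(l \<longlongrightarrow> f x) (at x)" "(u \<longlongrightarrow> f x) (at x)"
      using l u S x fx by (metis continuous_on_eq_continuous_at isCont_def)+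
    then show ?thesis
      unfolding isCont_def using ev bounds
      by (intro tendsto_sandwich[of l f "at x" u]) (auto elim: eventually_mono)
  next
    case False
    then show ?thesis
      using f S x continuous_on_eq_continuous_at[of "S - {c}" f] by (simp add: open_Diff)
  qed
qed

lemma weighted_mean_pos:
  fixes v x :: real
  assumes "0 \<le> v" "v \<le> 1" "0 < x"
  shows "0 < 1 - v + v * x"
  using assms by (cases "v = 1") (auto intro: add_pos_nonneg)

lemma continuous_on_weighted_mean_powr:
  fixes v r :: real
  assumes "0 \<le> v" "v \<le> 1"
  shows "continuous_on {0<..} (\<lambda>x. (1 - v + v * x) powr r)"
  using weighted_mean_pos[OF assms] by (intro continuous_intros) force

lemma continuous_on_log_mean:
  fixes v :: real
  assumes v: "0 \<le> v" "v \<le> 1"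
  shows "continuous_on {0<..} (\<lambda>x. log_mean v 1 x)"
proof (rule continuous_on_squeeze_at[where c = 1])
  show "continuous_on ({0<..} - {1}) (log_mean v 1)"
  proof (cases "v = 0 \<or> v = 1")
    case True
    have "continuous_on ({0<..} - {1}) (\<lambda>x. if v = 0 then 1 else x :: real)"
      by (cases "v = 0") (auto intro!: continuous_intros)
    moreover have "log_mean v 1 x = (if v = 0 then 1 else x)" for x
      using True by (auto simp: log_mean_def)
    ultimately show ?thesis
      by simp
  next
    case False
    with v have v': "0 < v" "v < 1"
      by auto
    have "continuous_on ({0<..} - {1}) (\<lambda>x. (1 - v) * ((x powr v - 1) / (v * ln x)) +
        v * ((x - x powr v) / ((1 - v) * ln x)))"
      using v' by (intro continuous_intros) auto
    moreover have "log_mean v 1 x = (1 - v) * ((x powr v - 1) / (v * ln x)) +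
        v * ((x - x powr v) / ((1 - v) * ln x))" if "x \<in> {0<..} - {1}" for x
      using log_mean_eq[of x v] that v' by (simp add: ln_powr left_diff_distrib)
    ultimately show ?thesis
      using continuous_on_cong by (metis (no_types, lifting))
  qed
  show "continuous_on {0<..} (\<lambda>x. (1 - v) * x powr (v/2) + v * x powr ((1+v)/2))"
    "continuous_on {0<..} (\<lambda>x. (x powr v + (1 - v + v * x)) / 2)"
    by (intro continuous_intros; simp)+
qed (use log_mean_bounds[OF _ v] in auto)

lemma continuous_on_identric_mean:
  fixes v :: real
  assumes v: "0 \<le> v" "v \<le> 1"
  shows "continuous_on {0<..} (\<lambda>x. identric_mean v 1 x)"
proof (rule continuous_on_squeeze_at[where c = 1])
  show "continuous_on ({0<..} - {1}) (identric_mean v 1)"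
  proof (cases "v = 0 \<or> v = 1")
    case True
    have "continuous_on ({0<..} - {1}) (\<lambda>x. if v = 0 then 1 else x :: real)"
      by (cases "v = 0") (auto intro!: continuous_intros)
    moreover have "identric_mean v 1 x = (if v = 0 then 1 else x)" for x
      using True by (auto simp: identric_mean_def)
    ultimately show ?thesis
      by simp
  next
    case False
    with v have v': "0 < v" "v < 1"
      by auto
    have "continuous_on ({0<..} - {1}) (\<lambda>x. 1 / exp 1 *
        (1 - v + v * x) powr ((1 - 2 * v) * (1 - v + v * x) / (v * (1 - v) * (x - 1))) *
        (x powr (v * x / (1 - v))) powr (1 / (x - 1)))"
      using v' by (intro continuous_intros) (auto dest: weighted_mean_pos[OF v])
    moreover have "identric_mean v 1 x = 1 / exp 1 *
        (1 - v + v * x) powr ((1 - 2 * v) * (1 - v + v * x) / (v * (1 - v) * (x - 1))) *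
        (x powr (v * x / (1 - v))) powr (1 / (x - 1))" if "x \<in> {0<..} - {1}" for x
      using that v' by (simp add: identric_mean_def Let_def)
    ultimately show ?thesis
      using continuous_on_cong by (metis (no_types, lifting))
  qed
  show "continuous_on {0<..} (\<lambda>x. (1 - v + v * x) powr (1/2) * (x powr v) powr (1/2))"
    using v by (intro continuous_on_mult continuous_on_weighted_mean_powr) (auto intro!: continuous_intros)
  show "continuous_on {0<..} (\<lambda>x. (1 - v/2 + v/2 * x) powr (1 - v) *
      (1 - (1+v)/2 + (1+v)/2 * x) powr v)"
    using v by (intro continuous_on_mult continuous_on_weighted_mean_powr) auto
qed (use identric_mean_bounds[OF _ v] in auto)

section \<open>The two chains of operator inequalities\<close>

theorem theorem4p2:
  fixes A B :: "'a::complex_hilbert_space \<Rightarrow>\<^sub>L 'a" and v :: real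
  assumes "A \<in> positive_invertible_ops" and "B \<in> positive_invertible_ops"
    and "0 \<le> v" and "v \<le> 1"
  shows "(A \<sharp>\<^bsub>v\<^esub> B \<preceq> (A \<sharp>\<^bsub>v/2\<^esub> B) \<nabla>\<^bsub>v\<^esub> (A \<sharp>\<^bsub>(1+v)/2\<^esub> B) \<and>
          (A \<sharp>\<^bsub>v/2\<^esub> B) \<nabla>\<^bsub>v\<^esub> (A \<sharp>\<^bsub>(1+v)/2\<^esub> B) \<preceq> op_log_mean v A B \<and>
          op_log_mean v A B \<preceq> (A \<sharp>\<^bsub>v\<^esub> B) \<nabla> (A \<nabla>\<^bsub>v\<^esub> B) \<and>
          (A \<sharp>\<^bsub>v\<^esub> B) \<nabla> (A \<nabla>\<^bsub>v\<^esub> B) \<preceq> A \<nabla>\<^bsub>v\<^esub> B) \<and>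
         (A \<sharp>\<^bsub>v\<^esub> B \<preceq> (A \<nabla>\<^bsub>v\<^esub> B) \<sharp> (A \<sharp>\<^bsub>v\<^esub> B) \<and>
          (A \<nabla>\<^bsub>v\<^esub> B) \<sharp> (A \<sharp>\<^bsub>v\<^esub> B) \<preceq> op_identric_mean v A B \<and>
          op_identric_mean v A B \<preceq> (A \<nabla>\<^bsub>v/2\<^esub> B) \<sharp>\<^bsub>v\<^esub> (A \<nabla>\<^bsub>(1+v)/2\<^esub> B) \<and>
          (A \<nabla>\<^bsub>v/2\<^esub> B) \<sharp>\<^bsub>v\<^esub> (A \<nabla>\<^bsub>(1+v)/2\<^esub> B) \<preceq> A \<nabla>\<^bsub>v\<^esub> B)"
proof -
  note AB = assms(1,2) and v = assms(3,4)
  define m where "m = (\<lambda>w x::real. 1 - w + w * x)"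
  have m_pos: "0 < m w x" if "0 \<le> w" "w \<le> 1" "0 < x" for w x
    using weighted_mean_pos[OF that] by (simp add: m_def)
  have m_cont: "continuous_on {0<..} (m w)" for w
    unfolding m_def by (intro continuous_intros)
  have m_powr_cont: "continuous_on {0<..} (\<lambda>x. m w x powr r)" if "0 \<le> w" "w \<le> 1" for w r
    unfolding m_def by (rule continuous_on_weighted_mean_powr[OF that])
  have arith: "A \<nabla>\<^bsub>w\<^esub> B = op_mean (m w) A B" for w
    unfolding m_def by (rule op_arith_mean_eq[OF AB])
  define p where "p = (\<lambda>w x::real. x powr w)"
  have p_pos: "0 < p w x" if "0 < x" for w x
    using that by (simp add: p_def)
  have p_cont: "continuous_on {0<..} (p w)" for w
    unfolding p_def by (rule continuous_on_powr_pos)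
  have geom: "A \<sharp>\<^bsub>w\<^esub> B = op_mean (p w) A B" for w
    by (simp add: op_geom_mean_def p_def)
  \<comment> \<open>The scalar functions of the four nested means, in the form in which the rules
    for means of \<open>op_mean\<close> yield them; hence the unevaluated
    \<open>1 - 1/2\<close>.\<close>
  define f1 where "f1 = (\<lambda>x. (1 - v) * p (v/2) x + v * p ((1+v)/2) x)"
  define f2 where "f2 = (\<lambda>x. (1 - 1/2) * p v x + 1/2 * m v x)"
  define g1 where "g1 = (\<lambda>x. m v x powr (1 - 1/2) * p v x powr (1/2))"
  define g2 where "g2 = (\<lambda>x. m (v/2) x powr (1 - v) * m ((1+v)/2) x powr v)"
  have eqs: "(A \<sharp>\<^bsub>v/2\<^esub> B) \<nabla>\<^bsub>v\<^esub> (A \<sharp>\<^bsub>(1+v)/2\<^esub> B) = op_mean f1 A B"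
    "(A \<sharp>\<^bsub>v\<^esub> B) \<nabla> (A \<nabla>\<^bsub>v\<^esub> B) = op_mean f2 A B"
    "(A \<nabla>\<^bsub>v\<^esub> B) \<sharp> (A \<sharp>\<^bsub>v\<^esub> B) = op_mean g1 A B"
    "(A \<nabla>\<^bsub>v/2\<^esub> B) \<sharp>\<^bsub>v\<^esub> (A \<nabla>\<^bsub>(1+v)/2\<^esub> B) = op_mean g2 A B"
    unfolding arith geom f1_def f2_def g1_def g2_def using v
    by (intro op_arith_mean_op_mean op_geom_mean_op_mean AB m_cont p_cont m_pos p_pos; simp)+
  have cont: "continuous_on {0<..} f1" "continuous_on {0<..} f2"
    "continuous_on {0<..} g1" "continuous_on {0<..} g2"
  proof -
    show "continuous_on {0<..} f1" "continuous_on {0<..} f2"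
      unfolding f1_def f2_def by (intro continuous_on_add continuous_on_mult continuous_on_const p_cont m_cont)+
    have "continuous_on {0<..} (\<lambda>x. p v x powr (1/2))"
      unfolding p_def powr_powr by (rule continuous_on_powr_pos)
    then show "continuous_on {0<..} g1"
      unfolding g1_def using v by (intro continuous_on_mult m_powr_cont)
    show "continuous_on {0<..} g2"
      unfolding g2_def using v by (intro continuous_on_mult m_powr_cont) auto
  qed
  have pm: "p v x \<le> m v x" if "0 < x" for x
    using weighted_AM_GM[of 1 x v] that v by (simp add: p_def m_def)
  have pf: "p v x \<le> f1 x" if x: "0 < x" for x
  proof -
    \<comment> \<open>The exponents add up to
      \<open>(1 - v) v / 2 + v (1 + v) / 2 = v\<close>.\<close>
    have "p v x = (x powr (v/2)) powr (1 - v) * (x powr ((1+v)/2)) powr v"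
      by (simp add: p_def powr_powr field_simps flip: powr_add)
    also have "\<dots> \<le> f1 x"
      unfolding f1_def p_def using x v by (intro weighted_AM_GM) auto
    finally show ?thesis .
  qed
  have pg: "p v x \<le> g1 x" if x: "0 < x" for x
  proof -
    \<comment> \<open>Only one of the two square roots is enlarged, by
      \<open>p v x \<le> m v x\<close>.\<close>
    have "p v x = p v x powr (1/2) * p v x powr (1/2)"
      using p_pos[OF x, of v] by (simp flip: powr_add)
    also have "\<dots> \<le> g1 x"
    proof -
      have "p v x powr (1/2) \<le> m v x powr (1/2)"
        using p_pos[OF x, of v] pm[OF x] by (intro powr_mono2) auto
      then show ?thesis
        by (simp add: g1_def mult_right_mono)
    qed
    finally show ?thesis .
  qed
  have gm: "g2 x \<le> m v x" if x: "0 < x" for x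
  proof -
    have "g2 x \<le> (1 - v) * m (v/2) x + v * m ((1+v)/2) x"
      unfolding g2_def using x v by (intro weighted_AM_GM m_pos) auto
    \<comment> \<open>Averaging the weights \<open>v/2\<close> and \<open>(1+v)/2\<close> with
      weight \<open>v\<close> gives back \<open>v\<close>.\<close>
    also have "\<dots> = m v x"
      by (simp add: m_def field_simps)
    finally show ?thesis .
  qed
  have fL: "f1 x \<le> log_mean v 1 x" "log_mean v 1 x \<le> f2 x" if "0 < x" for x
    using log_mean_bounds[OF that v] by (simp_all add: f1_def f2_def p_def m_def add_divide_distrib)
  have fm: "f2 x \<le> m v x" if "0 < x" for x
    using pm[OF that] by (simp add: f2_def)
  have gI: "g1 x \<le> identric_mean v 1 x" "identric_mean v 1 x \<le> g2 x" if "0 < x" for x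
    using identric_mean_bounds[OF that v] by (simp_all add: g1_def g2_def p_def m_def)
  show ?thesis
    \<comment> \<open>The nested means are replaced first, while their arguments still have operator
      form.\<close>
    unfolding eqs unfolding arith geom op_log_mean_def op_identric_mean_def
    by (intro conjI op_mean_mono AB cont p_cont m_cont continuous_on_log_mean[OF v]
        continuous_on_identric_mean[OF v] pf pg gm fL fm gI)
qed

end
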